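(* Let $\Bbbk$ be a field of characteristic $0$ and $n\ge3$. Let $\Omega_0\in\Bbbk[t_1,\dots,t_{n+1}]$ be an i.s. potential of degree $\ge n+1$. Let $N$ be the Nambu-Poisson field $Q(P_{\Omega_0-1})$ and let $K$ be another ($n$-Lie) Nambu-Poisson field of GK-dimension $n$. (1) If $\mathcal V_{-1}(K)\ne\emptyset$, then there is no Nambu-Poisson algebra morphism from $N$ to $K$. (2) If $K$ is either $N_{Weyl}$ or $Q(P_\Omega)$, where $\Omega\in\Bbbk[t_1,\dots,t_{n+1}]$ is an i.s. potential of degree $n+1+d_0$ with $d_0\ge0$ and $\deg\Omega\ne\sum_{i=1}^{n+1}\deg t_i=n+1$, then there is no Nambu-Poisson algebra morphism from $N$ to $K$.
   Context: A Nambu-Poisson algebra ($n$-Lie Poisson algebra) is a commutative $\Bbbk$-algebra $P$ with an $n$-ary $\Bbbk$-multilinear bracket $\{-,\dots,-\}$ that vanishes whenever two arguments are equal, satisfies $\{\{u_1,\dots,u_n\},v_1,\dots,v_{n-1}\}=\sum_{s=1}^n\{u_1,\dots,u_{s-1},\{u_s,v_1,\dots,v_{n-1}\},u_{s+1},\dots,u_n\}$, and satisfies the Leibniz rule in each argument. The bracket of a Nambu-Poisson domain $A$ extends uniquely to its fraction field $Q(A)$. Morphisms are (unital) $\Bbbk$-algebra maps preserving brackets. GK-dimension of a field over $\Bbbk$ equals its transcendence degree over $\Bbbk$. $N_{Weyl}$ is $\Bbbk(t_1,\dots,t_n)$ with $\{t_1,\dots,t_n\}=1$. For $w\in\mathbb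 Z$, a $w$-valuation on a Nambu-Poisson field $K$ is a map $\nu:K\to\mathbb Z\cup\{\infty\}$ such that for all $a,b,b_i\in K$: $\nu(a)=\infty$ iff $a=0$; $\nu(c)=0$ for $c\in\Bbbk^\times$; $\nu(ab)=\nu(a)+\nu(b)$; $\nu(a+b)\ge\min\{\nu(a),\nu(b)\}$ with equality if $\nu(a)\ne\nu(b)$; and $\nu(\{b_1,\dots,b_n\})\ge-w+\sum_{s=1}^n\nu(b_s)$. It is trivial if $\nu(a)=0$ for all $a\ne0$. $\mathcal V_w(K)$ is the set of nontrivial $w$-valuations on $K$. An i.s. potential is a homogeneous element $\Omega\in\Bbbk[t_1,\dots,t_{n+1}]$ (with $\deg t_i=1$ for all $i$) such that $\Bbbk[t_1,\dots,t_{n+1}]/(\Omega_{t_1},\dots,\Omega_{t_{n+1}})$ is finite-dimensional over $\Bbbk$, where $\Omega_{t_i}=\partial\Omega/\partial t_i$. $A_\Omega$ is $\Bbbk[t_1,\dots,t_{n+1}]$ with bracket $\{f_1,\dots,f_n\}=\det\frac{\partial(f_1,\dots,f_n,\Omega)}{\partial(t_1,\dots,t_{n+1})}$. For $\xi\in\Bbbk$, $P_{\Omega-\xi}=A_\Omega/(\Omega-\xi)$ with the induced bracket, and $P_\Omega=P_{\Omega-0}$. *)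

theory Defs
  imports
    "Jordan_Normal_Form.VS_Connect"
    "HOL-Algebra.QuotRing"
    "HOL-Library.Poly_Mapping"
    "HOL-Library.Extended"
    "HOL-Library.Extended_Real"
begin

section \<open>Nambu-Poisson algebras\<close>

text \<open>
  The base field is a type \<open>'k\<close> of class \<^class>\<open>field\<close>, viewed as the ring
  \<^term>\<open>class_ring :: 'k::field ring\<close>; algebras over it are records with explicit carriers.
  An \<open>n\<close>-ary bracket takes a list; only its values on lists of length \<open>n\<close> over the carrier matter.
\<close>

record ('k, 'a) nambu = "('k, 'a) module" +
  bracket :: "'a list \<Rightarrow> 'a" (\<open>\<lbrace>_\<rbrace>\<index>\<close>)

locale nambu_poisson_algebra = algebra "class_ring :: 'k::field ring" P
  for n :: nat and P :: "('k::field, 'a, 'm) nambu_scheme" (structure) +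
  assumes bracket_closed:
      "\<lbrakk>length us = n; set us \<subseteq> carrier P\<rbrakk> \<Longrightarrow> \<lbrace>us\<rbrace> \<in> carrier P"
    and bracket_add:
      "\<lbrakk>length us = n; set us \<subseteq> carrier P; i < n; x \<in> carrier P; y \<in> carrier P\<rbrakk>
        \<Longrightarrow> \<lbrace>us[i := x \<oplus> y]\<rbrace> = \<lbrace>us[i := x]\<rbrace> \<oplus> \<lbrace>us[i := y]\<rbrace>"
    and bracket_smult:
      "\<lbrakk>length us = n; set us \<subseteq> carrier P; i < n; x \<in> carrier P\<rbrakk>
        \<Longrightarrow> \<lbrace>us[i := c \<odot> x]\<rbrace> = c \<odot> \<lbrace>us[i := x]\<rbrace>"
    and bracket_alternating:
      "\<lbrakk>length us = n; set us \<subseteq> carrier P; i < j; j < n; us ! i = us ! j\<rbrakk>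
        \<Longrightarrow> \<lbrace>us\<rbrace> = \<zero>"
    and fundamental_identity:
      "\<lbrakk>length us = n; set us \<subseteq> carrier P; length vs = n - 1; set vs \<subseteq> carrier P\<rbrakk>
        \<Longrightarrow> \<lbrace>\<lbrace>us\<rbrace> # vs\<rbrace> = (\<Oplus>s\<in>{..<n}. \<lbrace>us[s := \<lbrace>us ! s # vs\<rbrace>]\<rbrace>)"
    and leibniz:
      "\<lbrakk>length us = n; set us \<subseteq> carrier P; i < n; x \<in> carrier P; y \<in> carrier P\<rbrakk>
        \<Longrightarrow> \<lbrace>us[i := x \<otimes> y]\<rbrace>
          = x \<otimes> \<lbrace>us[i := y]\<rbrace> \<oplus> y \<otimes> \<lbrace>us[i := x]\<rbrace>"

locale nambu_poisson_field = nambu_poisson_algebra n P + field P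
  for n :: nat and P :: "('k::field, 'a, 'm) nambu_scheme" (structure)

definition alg_hom ::
    "('k, 'a, 'm) module_scheme \<Rightarrow> ('k, 'b, 'l) module_scheme \<Rightarrow> ('a \<Rightarrow> 'b) set" where
  "alg_hom A B = {\<phi> \<in> Ring.ring_hom A B. \<forall>c. \<forall>x \<in> carrier A. \<phi> (c \<odot>\<^bsub>A\<^esub> x) = c \<odot>\<^bsub>B\<^esub> \<phi> x}"

definition nambu_hom ::
    "nat \<Rightarrow> ('k, 'a, 'm) nambu_scheme \<Rightarrow> ('k, 'b, 'l) nambu_scheme \<Rightarrow> ('a \<Rightarrow> 'b) set" where
  "nambu_hom n A B = {\<phi> \<in> alg_hom A B.
     \<forall>us. length us = n \<longrightarrow> set us \<subseteq> carrier A \<longrightarrow>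
       \<phi> (\<lbrace>us\<rbrace>\<^bsub>A\<^esub>) = \<lbrace>map \<phi> us\<rbrace>\<^bsub>B\<^esub>}"

text \<open>
  \<open>\<iota>\<close> exhibits the field \<open>K\<close> as the field of fractions of \<open>A\<close>. This determines \<open>K\<close> up to
  isomorphism, so ``\<open>Q(A)\<close>'' is rendered as: any \<open>K\<close> admitting such an \<open>\<iota>\<close>.
\<close>

definition fraction_embedding ::
    "('k, 'a, 'm) module_scheme \<Rightarrow> ('k, 'b, 'l) module_scheme \<Rightarrow> ('a \<Rightarrow> 'b) \<Rightarrow> bool" where
  "fraction_embedding A K \<iota> \<longleftrightarrow> \<iota> \<in> alg_hom A K \<and> inj_on \<iota> (carrier A) \<and>
     (\<forall>x \<in> carrier K. \<exists>a \<in> carrier A. \<exists>b \<in> carrier A - {\<zero>\<^bsub>A\<^esub>}. x = \<iota> a \<otimes>\<^bsub>K\<^esub> inv\<^bsub>K\<^esub> (\<iota> b))"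

text \<open>
  The bracket of \<open>K\<close> must restrict to that of \<open>A\<close>; being a derivation in each argument, it is
  then the unique extension of the bracket of \<open>A\<close>.
\<close>

definition is_nambu_fraction_field ::
    "nat \<Rightarrow> ('k::field, 'a, 'm) nambu_scheme \<Rightarrow> ('k, 'b, 'l) nambu_scheme \<Rightarrow> bool" where
  "is_nambu_fraction_field n A K \<longleftrightarrow>
     nambu_poisson_field n K \<and> (\<exists>\<iota> \<in> nambu_hom n A K. fraction_embedding A K \<iota>)"

section \<open>Valuations and GK-dimension\<close>

text \<open>
  \<open>\<int> \<union> {\<infinity>}\<close> is the part of \<^typ>\<open>int extended\<close> without \<^const>\<open>Minf\<close>;
  \<^const>\<open>Pinf\<close> is \<open>\<infinity>\<close>.
\<close>

definition is_valuation ::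
    "nat \<Rightarrow> int \<Rightarrow> ('k::field, 'a, 'm) nambu_scheme \<Rightarrow> ('a \<Rightarrow> int extended) \<Rightarrow> bool" where
  "is_valuation n w K \<nu> \<longleftrightarrow>
     (\<forall>a \<in> carrier K. \<nu> a \<noteq> Minf) \<and>
     (\<forall>a \<in> carrier K. \<nu> a = Pinf \<longleftrightarrow> a = \<zero>\<^bsub>K\<^esub>) \<and>
     (\<forall>c. c \<noteq> 0 \<longrightarrow> \<nu> (c \<odot>\<^bsub>K\<^esub> \<one>\<^bsub>K\<^esub>) = 0) \<and>
     (\<forall>a \<in> carrier K. \<forall>b \<in> carrier K. \<nu> (a \<otimes>\<^bsub>K\<^esub> b) = \<nu> a + \<nu> b) \<and>
     (\<forall>a \<in> carrier K. \<forall>b \<in> carrier K. \<nu> (a \<oplus>\<^bsub>K\<^esub> b) \<ge> min (\<nu> a) (\<nu> b)) \<and>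
     (\<forall>a \<in> carrier K. \<forall>b \<in> carrier K. \<nu> a \<noteq> \<nu> b \<longrightarrow> \<nu> (a \<oplus>\<^bsub>K\<^esub> b) = min (\<nu> a) (\<nu> b)) \<and>
     (\<forall>bs. length bs = n \<longrightarrow> set bs \<subseteq> carrier K \<longrightarrow>
        \<nu> (\<lbrace>bs\<rbrace>\<^bsub>K\<^esub>) \<ge> Fin (- w) + (\<Sum>b\<leftarrow>bs. \<nu> b))"

definition nontrivial_valuations ::
    "nat \<Rightarrow> int \<Rightarrow> ('k::field, 'a, 'm) nambu_scheme \<Rightarrow> ('a \<Rightarrow> int extended) set" where
  "nontrivial_valuations n w K =
     {\<nu>. is_valuation n w K \<nu> \<and> (\<exists>a \<in> carrier K. a \<noteq> \<zero>\<^bsub>K\<^esub> \<and> \<nu> a \<noteq> 0)}"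

text \<open>\<open>subspace_power A V m\<close> is \<open>V\<^sup>0 + V\<^sup>1 + \<dots> + V\<^sup>m\<close>, with \<open>V\<^sup>0 = \<bbbk>\<close>.\<close>

definition subspace_power ::
    "('k::field, 'a, 'm) module_scheme \<Rightarrow> 'a set \<Rightarrow> nat \<Rightarrow> 'a set" where
  "subspace_power A V m = LinearCombinations.module.span class_ring A
     {foldr (\<otimes>\<^bsub>A\<^esub>) xs \<one>\<^bsub>A\<^esub> |xs. set xs \<subseteq> V \<and> length xs \<le> m}"

definition gk_dim :: "('k::field, 'a, 'm) module_scheme \<Rightarrow> ereal" where
  "gk_dim A =
     (SUP V \<in> {V. VectorSpace.subspace class_ring V A \<and>
                  vectorspace.fin_dim class_ring (A\<lparr>carrier := V\<rparr>)}.
        limsup (\<lambda>m. ereal (log (real m)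
          (real (vectorspace.dim class_ring (A\<lparr>carrier := subspace_power A V m\<rparr>))))))"

section \<open>Polynomials\<close>

text \<open>
  Polynomials in countably many variables, as finitely supported functions from exponent
  vectors to coefficients. The variables are numbered from 0: \<open>var i\<close> is \<open>t\<^bsub>i+1\<^esub>\<close>, and
  \<open>polys N\<close> is \<open>\<bbbk>[t\<^sub>1,\<dots>,t\<^sub>N]\<close>.
\<close>

type_synonym 'k mvpoly = "(nat \<Rightarrow>\<^sub>0 nat) \<Rightarrow>\<^sub>0 'k"

definition const :: "'k::zero \<Rightarrow> 'k mvpoly" where
  "const c = Poly_Mapping.single 0 c"

definition var :: "nat \<Rightarrow> 'k::zero_neq_one mvpoly" where
  "var i = Poly_Mapping.single (Poly_Mapping.single i 1) 1"

definition polys :: "nat \<Rightarrow> 'k::zero mvpoly set" where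
  "polys N = {p. \<forall>m \<in> Poly_Mapping.keys p. Poly_Mapping.keys m \<subseteq> {..<N}}"

definition homogeneous :: "nat \<Rightarrow> 'k::zero mvpoly \<Rightarrow> bool" where
  "homogeneous d p \<longleftrightarrow>
     (\<forall>m \<in> Poly_Mapping.keys p. (\<Sum>i \<in> Poly_Mapping.keys m. Poly_Mapping.lookup m i) = d)"

text \<open>
  The truncated subtraction of exponents below is harmless: where it truncates, the
  coefficient is 0.
\<close>

definition partial_deriv :: "nat \<Rightarrow> 'k::semiring_1 mvpoly \<Rightarrow> 'k mvpoly" where
  "partial_deriv i p = (\<Sum>m \<in> Poly_Mapping.keys p.
     Poly_Mapping.single (m - Poly_Mapping.single i 1)
       (of_nat (Poly_Mapping.lookup m i) * Poly_Mapping.lookup p m))"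

definition poly_alg :: "nat \<Rightarrow> ('k::field, 'k mvpoly) module" where
  "poly_alg N = \<lparr>carrier = polys N, mult = (*), one = 1, zero = 0, add = (+),
     smult = (\<lambda>c p. const c * p)\<rparr>"

section \<open>Quotients, isolated singularities, and the algebras of a potential\<close>

text \<open>
  As for \<^const>\<open>rcoset_mult\<close>, an operation on cosets is the union of the cosets of its values
  on all representatives.
\<close>

definition quot_alg :: "('k, 'a, 'm) module_scheme \<Rightarrow> 'a set \<Rightarrow> ('k, 'a set) module" where
  "quot_alg A I = \<lparr>carrier = carrier (A Quot I), mult = mult (A Quot I), one = one (A Quot I),
     zero = zero (A Quot I), add = add (A Quot I),
     smult = (\<lambda>c X. \<Union>x \<in> X. I +>\<^bsub>A\<^esub> (c \<odot>\<^bsub>A\<^esub> x))\<rparr>"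

definition with_bracket :: "('k, 'a) module \<Rightarrow> ('a list \<Rightarrow> 'a) \<Rightarrow> ('k, 'a) nambu" where
  "with_bracket A br = \<lparr>carrier = carrier A, mult = mult A, one = one A, zero = zero A,
     add = add A, smult = smult A, bracket = br\<rparr>"

definition quot_nambu :: "('k, 'a, 'm) nambu_scheme \<Rightarrow> 'a set \<Rightarrow> ('k, 'a set) nambu" where
  "quot_nambu A I = with_bracket (quot_alg A I)
     (\<lambda>Xs. \<Union>xs \<in> listset Xs. I +>\<^bsub>A\<^esub> (\<lbrace>xs\<rbrace>\<^bsub>A\<^esub>))"

text \<open>
  An i.s. potential of degree \<open>d\<close> in \<open>N\<close> variables. For \<open>N > 0\<close> finite dimensionality
  excludes \<open>\<Omega> = 0\<close>, so \<open>d\<close> is determined by \<open>\<Omega>\<close>.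
\<close>

definition is_potential :: "nat \<Rightarrow> nat \<Rightarrow> 'k::field mvpoly \<Rightarrow> bool" where
  "is_potential N d \<Omega> \<longleftrightarrow> \<Omega> \<in> polys N \<and> homogeneous d \<Omega> \<and>
     vectorspace.fin_dim class_ring
       (quot_alg (poly_alg N) (Idl\<^bsub>poly_alg N\<^esub> {partial_deriv i \<Omega> |i. i < N}))"

definition A_alg :: "nat \<Rightarrow> 'k::field mvpoly \<Rightarrow> ('k, 'k mvpoly) nambu" where
  "A_alg n \<Omega> = with_bracket (poly_alg (n + 1))
     (\<lambda>fs. det (mat (n + 1) (n + 1) (\<lambda>(i, j). partial_deriv j ((fs @ [\<Omega>]) ! i))))"

text \<open>\<open>P\<^bsub>\<Omega>-\<xi>\<^esub>\<close>\<close>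

definition P_alg :: "nat \<Rightarrow> 'k::field mvpoly \<Rightarrow> 'k \<Rightarrow> ('k, 'k mvpoly set) nambu" where
  "P_alg n \<Omega> \<xi> = quot_nambu (A_alg n \<Omega>) (PIdl\<^bsub>A_alg n \<Omega>\<^esub> (\<Omega> - const \<xi>))"

text \<open>\<open>K\<close> is (a copy of) \<open>N\<^bsub>Weyl\<^esub>\<close>: the bracket of \<open>\<bbbk>(t\<^sub>1,\<dots>,t\<^sub>n)\<close> is determined by its value at the \<open>t\<^sub>i\<close>.\<close>

definition is_weyl_field :: "nat \<Rightarrow> ('k::field, 'a, 'm) nambu_scheme \<Rightarrow> bool" where
  "is_weyl_field n K \<longleftrightarrow> nambu_poisson_field n K \<and>
     (\<exists>\<iota>. fraction_embedding (poly_alg n) K \<iota> \<and>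
          \<lbrace>map (\<lambda>i. \<iota> (var i)) [0..<n]\<rbrace>\<^bsub>K\<^esub> = \<one>\<^bsub>K\<^esub>)"

end

theory Submission
  imports Defs
begin

text \<open>
  A \<open>(-1)\<close>-valuation on \<open>K\<close> pulls back along \<open>N \<rightarrow> K\<close>, and \<open>N\<close> carries none. For let \<open>m\<close> be the
  smallest value of a generator \<open>t\<^sub>i\<close> of \<open>P\<^bsub>\<Omega>\<^sub>0-1\<^esub>\<close>. The brackets of \<open>n\<close> generators are the partial
  derivatives of \<open>\<Omega>\<^sub>0\<close> up to sign, so these have value at least \<open>1 + n m\<close>, although they are forms of
  degree \<open>d - 1 \<ge> n\<close>. If \<open>m \<le> 0\<close>, this contradicts that a power of a generator of value \<open>m\<close> lies in
  the Jacobian ideal; if \<open>m > 0\<close>, then \<open>\<Omega>\<^sub>0\<close> has positive value, contradicting \<open>\<Omega>\<^sub>0 = 1\<close>.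

  It remains to find \<open>(-1)\<close>-valuations: \<open>-deg\<close> on the Weyl field, and the order with respect to the
  grading on \<open>Q(P\<^bsub>\<Omega>\<^esub>)\<close>. Both come from a homogeneous prime ideal of a polynomial ring, and since
  the bracket is a derivation in each slot, the inequality need only be checked on generators.
\<close>

section \<open>Polynomials\<close>

text \<open>No valuation on \<open>N\<close> is formed: all estimates take place in
  \<open>K\<close>, along the composite of polynomial ring, \<open>P_alg n \<Omega> 1\<close>,
  \<open>N\<close> and \<open>K\<close>. Membership of a power in the Jacobian ideal is needed in
  graded form, with forms of the right degree as coefficients, because the contradiction comes from
  weighing degrees against the value \<open>m\<close>.

  In the construction of valuations the obstacle is that an element has many polynomial
  representatives, so its value cannot be read off one of them. Filtrations avoid the choice. Their
  jumps are additive for two reasons: the kernel is homogeneous, so leading forms are visible in the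
  image, and \<open>K\<close> is a field, so products of leading forms survive.

  With generators of weight \<open>\<sigma>\<close>, brackets of generators must have value at least
  \<open>1 + n * \<sigma>\<close>, the 1 being \<open>- w\<close> for \<open>w = - 1\<close>. In the
  Weyl field such brackets are constants, of value 0 or \<infinity>, which meets the bound for
  \<open>\<sigma> = - 1\<close> but not for \<open>\<sigma> = 1\<close>. For a potential of degree
  \<open>d\<close> they are forms of degree \<open>d - 1\<close>, which suits
  \<open>\<sigma> = 1\<close> as soon as \<open>d \<ge> n + 2\<close>; this is how the condition on
  the degree enters.\<close>

definition mdeg :: "(nat \<Rightarrow>\<^sub>0 nat) \<Rightarrow> nat" where
  "mdeg m = (\<Sum>i \<in> Poly_Mapping.keys m. Poly_Mapping.lookup m i)"

lemma mdeg_superset: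
  assumes "finite A" "Poly_Mapping.keys m \<subseteq> A"
  shows "mdeg m = (\<Sum>i \<in> A. Poly_Mapping.lookup m i)"
  unfolding mdeg_def using assms
  by (intro sum.mono_neutral_left) (auto simp: in_keys_iff)

lemma mdeg_zero [simp]: "mdeg 0 = 0"
  by (simp add: mdeg_def)

lemma mdeg_add: "mdeg (m + m') = mdeg m + mdeg m'"
proof -
  let ?A = "Poly_Mapping.keys m \<union> Poly_Mapping.keys m'"
  have "mdeg (m + m') = (\<Sum>i \<in> ?A. Poly_Mapping.lookup (m + m') i)"
    by (intro mdeg_superset) (use keys_add[of m m'] in auto)
  also have "\<dots> = mdeg m + mdeg m'"
    by (simp add: lookup_add sum.distrib mdeg_superset[of ?A])
  finally show ?thesis .
qed

lemma mdeg_single [simp]: "mdeg (Poly_Mapping.single i k) = k"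
  by (simp add: mdeg_def)

lemma homogeneous_iff: "homogeneous d p \<longleftrightarrow> (\<forall>m \<in> Poly_Mapping.keys p. mdeg m = d)"
  by (simp add: homogeneous_def mdeg_def)

text \<open>A monomial is built from 1 by multiplying with one variable at a time; this is the
  induction for claims that are multiplicative or follow a Leibniz rule.\<close>

lemma mdeg_induct [case_names zero var]:
  fixes m :: "nat \<Rightarrow>\<^sub>0 nat"
  assumes "P 0" and "\<And>i m. P m \<Longrightarrow> P (Poly_Mapping.single i 1 + m)"
  shows "P m"
proof (induction "mdeg m" arbitrary: m)
  case 0
  then have "m = 0"
    by (intro poly_mapping_eqI) (auto simp: mdeg_def in_keys_iff)
  then show ?case using assms(1) by simp
next
  case (Suc k)
  then obtain i where i: "i \<in> Poly_Mapping.keys m"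
    by (metis mdeg_def sum.empty equals0I nat.distinct(1))
  define m' where "m' = m - Poly_Mapping.single i 1"
  have "m = Poly_Mapping.single i 1 + m'"
    unfolding m'_def using i
    by (intro poly_mapping_eqI)
      (auto simp: lookup_add lookup_minus lookup_single when_def in_keys_iff)
  with Suc assms(2) show ?case
    by (metis mdeg_add mdeg_single plus_1_eq_Suc Suc_inject)
qed

text \<open>With a condition on \<open>mdeg\<close> this is a homogeneous component; with the
  negated condition it is the sum of all other components.\<close>

definition part :: "('a \<Rightarrow> bool) \<Rightarrow> ('a \<Rightarrow>\<^sub>0 'k::comm_monoid_add) \<Rightarrow> ('a \<Rightarrow>\<^sub>0 'k)" where
  "part P p = (\<Sum>m \<in> {m \<in> Poly_Mapping.keys p. P m}. Poly_Mapping.single m (Poly_Mapping.lookup p m))"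

lemma lookup_part:
  "Poly_Mapping.lookup (part P p) m = (if P m then Poly_Mapping.lookup p m else 0)"
  by (auto simp: part_def lookup_sum lookup_single when_def in_keys_iff)

lemma keys_part: "Poly_Mapping.keys (part P p) = {m \<in> Poly_Mapping.keys p. P m}"
  by (auto simp: in_keys_iff lookup_part split: if_splits)

lemma part_split: "part P p + part (\<lambda>m. \<not> P m) p = p"
  by (intro poly_mapping_eqI) (simp add: lookup_add lookup_part)

lemma part_True [simp]: "part (\<lambda>m. True) p = p"
  by (intro poly_mapping_eqI) (simp add: lookup_part)

lemma add_eq_zero_disjoint_keys:
  fixes p q :: "'a \<Rightarrow>\<^sub>0 'k::comm_monoid_add"
  assumes "p + q = 0" "Poly_Mapping.keys p \<inter> Poly_Mapping.keys q = {}"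
  shows "p = 0"
proof (rule poly_mapping_eqI)
  fix m
  have "Poly_Mapping.lookup p m + Poly_Mapping.lookup q m = 0"
    by (metis assms(1) lookup_add lookup_zero)
  moreover have "Poly_Mapping.lookup p m = 0 \<or> Poly_Mapping.lookup q m = 0"
    using assms(2) by (auto simp: in_keys_iff)
  ultimately show "Poly_Mapping.lookup p m = Poly_Mapping.lookup 0 m" by auto
qed

text \<open>The case \<open>single\<close> is asked only for exponents of the given
  \<open>p\<close>, so that facts about \<open>p\<close>, such as membership in
  \<open>polys N\<close>, can be used there.\<close>

lemma poly_mapping_monomial_induct [consumes 0, case_names zero single add]:
  fixes p :: "'a \<Rightarrow>\<^sub>0 'k::comm_monoid_add"
  assumes "P 0" and "\<And>m c. m \<in> Poly_Mapping.keys p \<Longrightarrow> P (Poly_Mapping.single m c)"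
    and "\<And>q r. P q \<Longrightarrow> P r \<Longrightarrow> P (q + r)"
  shows "P p"
proof -
  have "P (\<Sum>m \<in> A. Poly_Mapping.single m (Poly_Mapping.lookup p m))"
    if "A \<subseteq> Poly_Mapping.keys p" for A
    using finite_subset[OF that finite_keys] that
    by (induction A rule: finite_induct) (use assms in auto)
  from this[of "Poly_Mapping.keys p"] show ?thesis
    using part_True[of p] by (simp add: part_def del: part_True)
qed

section \<open>The polynomial ring in \<open>N\<close> variables\<close>

lemma polys_zero [simp]: "0 \<in> polys N" by (simp add: polys_def)

lemma polys_one [simp]: "1 \<in> polys N" by (auto simp: polys_def)

lemma polys_add [intro]: "p \<in> polys N \<Longrightarrow> q \<in> polys N \<Longrightarrow> p + q \<in> polys N"
  using keys_add[of p q] unfolding polys_def by blast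

lemma keys_uminus [simp]: "Poly_Mapping.keys (- p) = Poly_Mapping.keys (p :: 'a \<Rightarrow>\<^sub>0 'k::ab_group_add)"
  by (auto simp: in_keys_iff)

lemma polys_uminus [intro]: "p \<in> polys N \<Longrightarrow> - p \<in> polys N" for p :: "'k::ab_group_add mvpoly"
  by (simp add: polys_def)

lemma polys_diff [intro]: "p \<in> polys N \<Longrightarrow> q \<in> polys N \<Longrightarrow> p - q \<in> polys N"
  for p :: "'k::ab_group_add mvpoly"
  using polys_add[of p N "- q"] by auto

lemma polys_mult [intro]: "p \<in> polys N \<Longrightarrow> q \<in> polys N \<Longrightarrow> p * q \<in> polys N"
  for p :: "'k::comm_semiring_0 mvpoly"
  unfolding polys_def
proof (safe, goal_cases)
  case (1 m i)
  then obtain a b where "m = a + b" "a \<in> Poly_Mapping.keys p" "b \<in> Poly_Mapping.keys q"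
    using keys_mult[of p q] by blast
  with 1 keys_add[of a b] show ?case by blast
qed

lemma polys_single: "Poly_Mapping.keys m \<subseteq> {..<N} \<Longrightarrow> Poly_Mapping.single m c \<in> polys N"
  by (simp add: polys_def)

lemma polys_const [simp]: "const c \<in> polys N"
  by (simp add: const_def polys_single)

lemma polys_var [intro]: "i < N \<Longrightarrow> var i \<in> polys N"
  by (simp add: var_def polys_single)

lemma polys_sum [intro]: "(\<And>x. x \<in> A \<Longrightarrow> f x \<in> polys N) \<Longrightarrow> sum f A \<in> polys N"
  by (induction A rule: infinite_finite_induct) auto

lemma polys_prod [intro]: "(\<And>x. x \<in> A \<Longrightarrow> f x \<in> polys N) \<Longrightarrow> prod f A \<in> polys N"
  for f :: "_ \<Rightarrow> 'k::comm_semiring_1 mvpoly"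
  by (induction A rule: infinite_finite_induct) auto

lemma polys_power [intro]: "p \<in> polys N \<Longrightarrow> p ^ k \<in> polys N"
  for p :: "'k::comm_semiring_1 mvpoly"
  by (induction k) auto

lemma polys_part [intro]: "p \<in> polys N \<Longrightarrow> part P p \<in> polys N"
  by (auto simp: polys_def keys_part)

section \<open>Homogeneous polynomials\<close>

lemma homogeneous_zero [simp]: "homogeneous d 0" by (simp add: homogeneous_def)

lemma homogeneous_one [simp]: "homogeneous 0 1" by (simp add: homogeneous_iff)

lemma homogeneous_var: "homogeneous 1 (var i)" by (simp add: homogeneous_iff var_def)

lemma homogeneous_const: "homogeneous 0 (const c)" by (simp add: homogeneous_iff const_def)

lemma homogeneous_add: "homogeneous d p \<Longrightarrow> homogeneous d q \<Longrightarrow> homogeneous d (p + q)"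
  using keys_add[of p q] by (auto simp: homogeneous_iff)

lemma homogeneous_uminus: "homogeneous d p \<Longrightarrow> homogeneous d (- p)"
  for p :: "'k::ab_group_add mvpoly"
  by (simp add: homogeneous_iff)

lemma homogeneous_mult:
  "homogeneous d p \<Longrightarrow> homogeneous e q \<Longrightarrow> homogeneous (d + e) (p * q)"
  for p :: "'k::comm_semiring_0 mvpoly"
  using keys_mult[of p q] unfolding homogeneous_iff by (force simp: mdeg_add)

lemma homogeneous_sum: "(\<And>x. x \<in> A \<Longrightarrow> homogeneous d (f x)) \<Longrightarrow> homogeneous d (sum f A)"
  by (induction A rule: infinite_finite_induct) (auto intro: homogeneous_add)

lemma homogeneous_prod:
  "(\<And>x. x \<in> A \<Longrightarrow> homogeneous (d x) (f x)) \<Longrightarrow> homogeneous (sum d A) (prod f A)"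
  for f :: "_ \<Rightarrow> 'k::comm_semiring_1 mvpoly"
  by (induction A rule: infinite_finite_induct) (auto intro: homogeneous_mult)

lemma homogeneous_part: "homogeneous e (part (\<lambda>m. mdeg m = e) p)"
  by (simp add: homogeneous_iff keys_part)

section \<open>Partial derivatives\<close>

lemma partial_deriv_superset:
  assumes "finite A" "Poly_Mapping.keys p \<subseteq> A"
  shows "partial_deriv i p = (\<Sum>m \<in> A. Poly_Mapping.single (m - Poly_Mapping.single i 1)
       (of_nat (Poly_Mapping.lookup m i) * Poly_Mapping.lookup p m))"
  unfolding partial_deriv_def using assms
  by (intro sum.mono_neutral_left) (auto simp: in_keys_iff)

lemma partial_deriv_add: "partial_deriv i (p + q) = partial_deriv i p + partial_deriv i q"
proof -
  let ?A = "Poly_Mapping.keys p \<union> Poly_Mapping.keys q"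
  show ?thesis
    using keys_add[of p q]
    by (simp add: partial_deriv_superset[of ?A] lookup_add distrib_left single_add sum.distrib)
qed

lemma partial_deriv_zero [simp]: "partial_deriv i 0 = 0"
  by (simp add: partial_deriv_def)

lemma partial_deriv_uminus: "partial_deriv i (- p) = - partial_deriv i p"
  for p :: "'k::ring_1 mvpoly"
  using partial_deriv_add[of i p "- p"] by (simp add: eq_neg_iff_add_eq_0 add.commute)

lemma partial_deriv_diff: "partial_deriv i (p - q) = partial_deriv i p - partial_deriv i q"
  for p :: "'k::ring_1 mvpoly"
  using partial_deriv_add[of i p "- q"] by (simp add: partial_deriv_uminus)

lemma partial_deriv_single:
  "partial_deriv i (Poly_Mapping.single m c)
    = Poly_Mapping.single (m - Poly_Mapping.single i 1) (of_nat (Poly_Mapping.lookup m i) * c)"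
  by (cases "c = 0") (simp_all add: partial_deriv_def)

lemma partial_deriv_const [simp]: "partial_deriv i (const c) = 0"
  by (simp add: const_def partial_deriv_single)

lemma partial_deriv_var: "partial_deriv i (var j) = (if i = j then 1 else 0)"
  by (auto simp: var_def partial_deriv_single lookup_single when_def)

lemma single_minus_add:
  "Poly_Mapping.lookup m i \<noteq> 0 \<Longrightarrow>
    m' + (m - Poly_Mapping.single i (Suc 0)) = m' + m - Poly_Mapping.single i (Suc 0)"
  by (intro poly_mapping_eqI) (auto simp: lookup_add lookup_minus lookup_single when_def)

lemma partial_deriv_mult_single:
  fixes c c' :: "'k::comm_semiring_1"
  shows "partial_deriv i (Poly_Mapping.single m c * Poly_Mapping.single m' c')
    = Poly_Mapping.single m c * partial_deriv i (Poly_Mapping.single m' c')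
      + Poly_Mapping.single m' c' * partial_deriv i (Poly_Mapping.single m c)"
proof -
  let ?e = "Poly_Mapping.single i (1::nat)"
  \<comment> \<open>If \<open>i\<close> has exponent 0 in \<open>m\<close>, both coefficients
    vanish; otherwise the subtraction of \<open>?e\<close> does not truncate and commutes with the
    addition of \<open>m'\<close>.\<close>
  have *: "Poly_Mapping.single (m' + (m - ?e)) (c' * (of_nat (Poly_Mapping.lookup m i) * c))
    = Poly_Mapping.single (m + m' - ?e) (c' * (of_nat (Poly_Mapping.lookup m i) * c))"
    for m m' and c c' :: 'k
    by (cases "Poly_Mapping.lookup m i = 0") (simp_all add: single_minus_add add.commute[of m])
  have "partial_deriv i (Poly_Mapping.single m c * Poly_Mapping.single m' c')
    = Poly_Mapping.single (m + m' - ?e) (c * (of_nat (Poly_Mapping.lookup m' i) * c')) +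
      Poly_Mapping.single (m + m' - ?e) (c' * (of_nat (Poly_Mapping.lookup m i) * c))"
    by (simp add: mult_single partial_deriv_single lookup_add distrib_right distrib_left mult_ac add.commute
        flip: single_add)
  also have "\<dots> = Poly_Mapping.single m c * partial_deriv i (Poly_Mapping.single m' c')
      + Poly_Mapping.single m' c' * partial_deriv i (Poly_Mapping.single m c)"
    using *[of m' m c' c] *[of m m' c c']
    by (simp only: mult_single partial_deriv_single add.commute[of m' m])
  finally show ?thesis .
qed

text \<open>Both sides are additive in \<open>p\<close> and in \<open>q\<close>, which leaves the
  case of two monomials.\<close>

lemma partial_deriv_mult:
  "partial_deriv i (p * q) = p * partial_deriv i q + q * partial_deriv i p"
  for p q :: "'k::comm_semiring_1 mvpoly"
proof (induction p rule: poly_mapping_monomial_induct)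
  case (single m c)
  show ?case
    by (induction q rule: poly_mapping_monomial_induct)
      (auto simp: partial_deriv_mult_single partial_deriv_add algebra_simps)
qed (auto simp: partial_deriv_add algebra_simps)

lemma polys_partial_deriv [intro]: "p \<in> polys N \<Longrightarrow> partial_deriv i p \<in> polys N"
  unfolding partial_deriv_def
  by (intro polys_sum polys_single)
    (auto simp: polys_def in_keys_iff lookup_minus subset_iff)

text \<open>A term without the variable \<open>i\<close> is killed, and any other term has positive
  degree; so \<open>d - 1\<close> is a true subtraction wherever it matters.\<close>

lemma homogeneous_partial_deriv:
  assumes "homogeneous d p"
  shows "homogeneous (d - 1) (partial_deriv i p)"
  unfolding partial_deriv_def
proof (intro homogeneous_sum)
  fix m assume m: "m \<in> Poly_Mapping.keys p"
  let ?e = "Poly_Mapping.single i (1::nat)"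
  show "homogeneous (d - 1) (Poly_Mapping.single (m - ?e)
    (of_nat (Poly_Mapping.lookup m i) * Poly_Mapping.lookup p m))"
  proof (cases "Poly_Mapping.lookup m i = 0")
    case False
    then have "?e + (m - ?e) = m"
      by (intro poly_mapping_eqI) (auto simp: lookup_add lookup_minus lookup_single when_def)
    then have "mdeg m = 1 + mdeg (m - ?e)"
      by (metis mdeg_add mdeg_single)
    with assms m show ?thesis by (auto simp: homogeneous_iff)
  qed simp
qed

section \<open>Quotients of polynomial algebras\<close>

lemma const_add: "const (c + d) = const c + const d"
  by (simp add: const_def single_add)

lemma const_mult: "const (c * d) = const c * const d"
  by (simp add: const_def mult_single)

lemma const_one [simp]: "const 1 = 1" by (simp add: const_def)

lemma const_zero [simp]: "const 0 = 0" by (simp add: const_def)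

lemma const_uminus: "const (- c) = - const c" for c :: "'k::ring_1"
  by (simp add: const_def single_uminus)

lemma class_ring_cring: "cring (class_ring :: 'k::comm_ring_1 ring)"
  by (rule class_cring.is_cring)

text \<open>\<open>poly_alg\<close> and \<open>A_alg\<close> share their ring structure but are
  records of different types; the locale serves both.\<close>

locale polynomial_algebra =
  fixes N :: nat and R :: "('k::field, 'k mvpoly, 'm) module_scheme" (structure)
  assumes carrier_R [simp]: "carrier R = polys N"
    and mult_R [simp]: "mult R = (*)"
    and one_R [simp]: "one R = 1"
    and zero_R [simp]: "zero R = 0"
    and add_R [simp]: "add R = (+)"
    and smult_R [simp]: "smult R = (\<lambda>c p. const c * p)"
begin

lemma is_cring: "cring R"
proof (rule cringI)
  show "abelian_group R"
  proof (rule abelian_groupI)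
    fix x assume "x \<in> carrier R"
    then show "\<exists>y\<in>carrier R. y \<oplus> x = \<zero>"
      by (intro bexI[of _ "- x"]) auto
  qed (auto simp: ac_simps)
  show "comm_monoid R"
    by (rule comm_monoidI) (auto simp: ac_simps)
qed (auto simp: algebra_simps)

lemma is_algebra: "algebra class_ring R"
  by (rule algebraI)
    (auto simp: is_cring class_ring_cring const_add const_mult algebra_simps)

sublocale algebra class_ring R
  by (rule is_algebra)

lemma a_minus_R: "x \<in> polys N \<Longrightarrow> y \<in> polys N \<Longrightarrow> x \<ominus> y = x - y"
proof -
  assume xy: "x \<in> polys N" "y \<in> polys N"
  have "\<ominus> y = - y"
    by (rule M.minus_equality) (use xy in auto)
  then show ?thesis by (simp add: a_minus_def)
qed

end

lemma polynomial_algebra_poly_alg: "polynomial_algebra N (poly_alg N)"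
  by unfold_locales (simp_all add: poly_alg_def)

lemma polynomial_algebra_A_alg: "polynomial_algebra (n + 1) (A_alg n \<Omega>)"
  by unfold_locales (simp_all add: A_alg_def with_bracket_def poly_alg_def)

locale polynomial_quotient = polynomial_algebra + I?: ideal I R for I
begin

abbreviation proj :: "'a mvpoly \<Rightarrow> 'a mvpoly set" where
  "proj p \<equiv> I +> p"

abbreviation Q :: "('a, 'a mvpoly set) module" where
  "Q \<equiv> quot_alg R I"

lemma I_subset: "I \<subseteq> polys N"
  using a_subset by simp

lemma proj_eq_iff: "p \<in> polys N \<Longrightarrow> q \<in> polys N \<Longrightarrow> proj p = proj q \<longleftrightarrow> p - q \<in> I"
  using ring.quotient_eq_iff_same_a_r_cos[OF cring.axioms(1)[OF is_cring] is_ideal, of p q] a_minus_R[of p q] by simp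

lemma I_mult: "p \<in> polys N \<Longrightarrow> q \<in> I \<Longrightarrow> p * q \<in> I"
  using is_ideal ideal.I_l_closed[of I R q p] by simp

lemma I_add: "p \<in> I \<Longrightarrow> q \<in> I \<Longrightarrow> p + q \<in> I"
  using additive_subgroup.a_closed[OF is_additive_subgroup, of p q] by simp

lemma I_zero: "0 \<in> I"
  using additive_subgroup.zero_closed[OF is_additive_subgroup] by simp

lemma mem_proj_iff: "p \<in> polys N \<Longrightarrow> q \<in> proj p \<longleftrightarrow> q \<in> polys N \<and> q - p \<in> I"
proof -
  assume p: "p \<in> polys N"
  have "q \<in> proj p \<longleftrightarrow> (\<exists>h\<in>I. q = h + p)"
    by (auto simp: a_r_coset_def')
  also have "\<dots> \<longleftrightarrow> q \<in> polys N \<and> q - p \<in> I"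
    using p I_subset by (auto intro!: polys_add bexI[of _ "q - p"])
  finally show ?thesis .
qed

lemma carrier_Q: "carrier Q = proj ` polys N"
  by (auto simp: quot_alg_def FactRing_def A_RCOSETS_def')

lemma Q_ops:
  "mult Q = mult (R Quot I)" "one Q = one (R Quot I)" "zero Q = zero (R Quot I)"
  "add Q = add (R Quot I)" "carrier Q = carrier (R Quot I)"
  by (simp_all add: quot_alg_def)

lemma proj_hom:
  assumes "p \<in> polys N" "q \<in> polys N"
  shows "proj p \<otimes>\<^bsub>Q\<^esub> proj q = proj (p * q)" "proj p \<oplus>\<^bsub>Q\<^esub> proj q = proj (p + q)"
    "\<one>\<^bsub>Q\<^esub> = proj 1" "\<zero>\<^bsub>Q\<^esub> = proj 0"
proof -
  show "proj p \<otimes>\<^bsub>Q\<^esub> proj q = proj (p * q)" "proj p \<oplus>\<^bsub>Q\<^esub> proj q = proj (p + q)"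
    "\<one>\<^bsub>Q\<^esub> = proj 1"
    using ring_hom_mult[OF rcos_ring_hom, of p q] ring_hom_add[OF rcos_ring_hom, of p q]
      ring_hom_one[OF rcos_ring_hom] assms
    by (simp_all add: Q_ops)
  have "proj 0 = I"
    using I_subset by (auto simp: mem_proj_iff)
  then show "\<zero>\<^bsub>Q\<^esub> = proj 0"
    by (simp add: quot_alg_def FactRing_def)
qed

lemma proj_smult:
  assumes p: "p \<in> polys N"
  shows "c \<odot>\<^bsub>Q\<^esub> proj p = proj (const c * p)"
proof -
  \<comment> \<open>Every representative leads to the same coset, so the union that defines
    \<open>smult\<close> on the quotient collapses; it is nonempty because \<open>p\<close> lies in
    its own coset.\<close>
  have *: "proj (const c * x) = proj (const c * p)" if "x \<in> proj p" for x
    using that p I_mult[of "const c" "x - p"]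
    by (subst proj_eq_iff) (auto simp: mem_proj_iff right_diff_distrib)
  have "p \<in> proj p"
    using p by (simp add: mem_proj_iff I_zero)
  then have "(\<Union>x \<in> proj p. proj (const c * x)) = proj (const c * p)"
    using * by (metis (no_types, lifting) SUP_eq_const empty_iff)
  then show ?thesis
    by (simp add: quot_alg_def)
qed

lemma cring_Q: "cring Q"
proof (rule cringI)
  show "abelian_group Q"
  proof (rule abelian_groupI)
    fix x assume "x \<in> carrier Q"
    then obtain p where "p \<in> polys N" "x = proj p" by (auto simp: carrier_Q)
    then show "\<exists>y\<in>carrier Q. y \<oplus>\<^bsub>Q\<^esub> x = \<zero>\<^bsub>Q\<^esub>"
      by (intro bexI[of _ "proj (- p)"]) (auto simp: carrier_Q proj_hom polys_uminus)
  qed (auto simp: carrier_Q proj_hom(2) proj_hom(4)[of 0 0] polys_add ac_simps)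
  show "comm_monoid Q"
    by (rule comm_monoidI)
      (auto simp: carrier_Q proj_hom(1) proj_hom(3)[of 0 0] polys_mult ac_simps)
qed (auto simp: carrier_Q proj_hom(1,2) polys_mult polys_add algebra_simps)

lemma algebra_Q: "algebra class_ring Q"
  by (rule algebraI)
    (auto simp: cring_Q class_ring_cring carrier_Q proj_hom(1,2) proj_smult const_add const_mult
      polys_mult polys_add algebra_simps)

lemma proj_alg_hom: "proj \<in> alg_hom R Q"
  by (auto simp: alg_hom_def Ring.ring_hom_def carrier_Q proj_hom(1,2) proj_hom(3)[of 0 0] proj_smult)

lemma vectorspace_Q: "vectorspace class_ring Q"
proof -
  interpret Q: algebra class_ring Q by (rule algebra_Q)
  interpret F: field "class_ring :: 'a ring" by (rule class_field)
  show ?thesis by unfold_locales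
qed

lemma finsum_proj:
  assumes "finite B" "\<And>k. k \<in> B \<Longrightarrow> f k \<in> polys N"
  shows "(\<Oplus>\<^bsub>Q\<^esub>k\<in>B. proj (f k)) = proj (\<Sum>k\<in>B. f k)"
proof -
  interpret Q: algebra class_ring Q by (rule algebra_Q)
  show ?thesis using assms
  proof (induction B rule: finite_induct)
    case (insert x B)
    then show ?case
      by (subst Q.M.finsum_insert) (auto simp: carrier_Q proj_hom polys_sum)
  qed (simp add: proj_hom(4)[of 0 0])
qed

text \<open>Infinitely many vectors of a finite-dimensional space satisfy a nontrivial linear
  relation, which is pulled back here to a polynomial in \<open>t\<close> that lies in the
  ideal.\<close>

lemma fin_dim_powers_dependent:
  assumes fd: "vectorspace.fin_dim class_ring Q" and t: "t \<in> polys N"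
  shows "\<exists>B c k. finite B \<and> k \<in> B \<and> c k \<noteq> 0 \<and> (\<Sum>j\<in>B. const (c j) * t ^ j) \<in> I"
\<comment> \<open>Linear dependence is a property of a set of vectors and does not see that two
  powers coincide; such a coincidence gives the relation \<open>t ^ i - t ^ j\<close>
  directly.\<close>
proof (cases "inj (\<lambda>k. proj (t ^ k))")
  case False
  then obtain i j where ij: "i \<noteq> j" "proj (t ^ i) = proj (t ^ j)"
    by (auto simp: inj_on_def)
  then have "t ^ i - t ^ j \<in> I"
    using t by (simp add: proj_eq_iff polys_power)
  with ij(1) show ?thesis
    by (intro exI[of _ "{i, j}"] exI[of _ "\<lambda>k. if k = i then 1 else - 1"] exI[of _ i])
      (auto simp: const_uminus)
next
  case True
  interpret V: vectorspace class_ring Q by (rule vectorspace_Q)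
  let ?y = "\<lambda>k. proj (t ^ k)"
  have sub: "range ?y \<subseteq> carrier Q"
    using t by (auto simp: carrier_Q)
  have "infinite (range ?y)"
    using True by (simp add: finite_image_iff)
  with V.fin_dim_li_fin[OF fd _ sub] have "V.lin_dep (range ?y)" by blast
  then obtain A a v where A: "finite A" "A \<subseteq> range ?y" "v \<in> A" "a v \<noteq> 0"
    and lc: "V.lincomb a A = \<zero>\<^bsub>Q\<^esub>"
    by (auto simp: V.lin_dep_def)
  define B where "B = ?y -` A"
  have B: "finite B" "?y ` B = A" "inj_on ?y B"
    using A(1,2) True by (auto simp: B_def finite_vimageI inj_on_def)
  have "V.lincomb a A = (\<Oplus>\<^bsub>Q\<^esub>k\<in>B. a (?y k) \<odot>\<^bsub>Q\<^esub> ?y k)"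
    unfolding V.lincomb_def B(2)[symmetric]
    using B sub t by (subst V.M.finsum_reindex) (auto simp: proj_smult carrier_Q polys_power polys_mult)
  also have "\<dots> = (\<Oplus>\<^bsub>Q\<^esub>k\<in>B. proj (const (a (?y k)) * t ^ k))"
    using t by (simp add: proj_smult polys_power)
  also have "\<dots> = proj (\<Sum>k\<in>B. const (a (?y k)) * t ^ k)"
    using t B by (intro finsum_proj) auto
  finally have "(\<Sum>k\<in>B. const (a (?y k)) * t ^ k) \<in> I"
    using lc t proj_eq_iff[of "\<Sum>k\<in>B. const (a (?y k)) * t ^ k" 0]
    by (simp add: proj_hom(4)[of 0 0] polys_sum polys_mult polys_power)
  moreover obtain k where "k \<in> B" "v = ?y k"
    using A(3) B(2) by auto
  ultimately show ?thesis
    using A(4) B(1) by (intro exI[of _ B] exI[of _ "\<lambda>k. a (?y k)"] exI[of _ k]) auto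
qed

end

section \<open>Jacobian ideals and Jacobian determinants\<close>

text \<open>Counterpart of \<open>homogeneous\<close>: the component of degree \<open>e\<close> is
  absent. An equation can be split into a form of degree \<open>e\<close> and a remainder without
  naming the other components.\<close>

definition avoids_degree :: "nat \<Rightarrow> 'k::zero mvpoly \<Rightarrow> bool" where
  "avoids_degree e p \<longleftrightarrow> (\<forall>m \<in> Poly_Mapping.keys p. mdeg m \<noteq> e)"

lemma avoids_degree_zero [simp]: "avoids_degree e 0"
  by (simp add: avoids_degree_def)

lemma avoids_degree_add: "avoids_degree e p \<Longrightarrow> avoids_degree e q \<Longrightarrow> avoids_degree e (p + q)"
  using keys_add[of p q] by (auto simp: avoids_degree_def)

lemma avoids_degree_uminus [simp]: "avoids_degree e (- p) \<longleftrightarrow> avoids_degree e p"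
  for p :: "'k::ab_group_add mvpoly"
  by (simp add: avoids_degree_def)

lemma avoids_degree_diff: "avoids_degree e p \<Longrightarrow> avoids_degree e q \<Longrightarrow> avoids_degree e (p - q)"
  for p :: "'k::ab_group_add mvpoly"
  using avoids_degree_add[of e p "- q"] by simp

lemma avoids_degree_sum: "(\<And>x. x \<in> A \<Longrightarrow> avoids_degree e (f x)) \<Longrightarrow> avoids_degree e (sum f A)"
  by (induction A rule: infinite_finite_induct) (auto intro: avoids_degree_add)

lemma homogeneous_avoids_degree: "homogeneous d p \<Longrightarrow> d \<noteq> e \<Longrightarrow> avoids_degree e p"
  by (auto simp: homogeneous_iff avoids_degree_def)

lemma avoids_degree_mult:
  "avoids_degree d p \<Longrightarrow> homogeneous e q \<Longrightarrow> avoids_degree (d + e) (p * q)"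
  for p :: "'k::comm_semiring_0 mvpoly"
  using keys_mult[of p q] unfolding homogeneous_iff avoids_degree_def by (force simp: mdeg_add)

lemma avoids_degree_part: "avoids_degree e (part (\<lambda>m. mdeg m \<noteq> e) p)"
  by (simp add: avoids_degree_def keys_part)

text \<open>The summands have no exponent in common, so nothing can cancel. This is how the
  component of degree \<open>e\<close> of an equation is read off.\<close>

lemma homogeneous_add_avoids_degree_eq_zero:
  fixes p q :: "'k::comm_monoid_add mvpoly"
  assumes "p + q = 0" "homogeneous e p" "avoids_degree e q"
  shows "p = 0"
  by (rule add_eq_zero_disjoint_keys[OF assms(1)])
    (use assms(2,3) in \<open>auto simp: homogeneous_iff avoids_degree_def\<close>)

lemma homogeneous_power: "homogeneous d p \<Longrightarrow> homogeneous (d * k) (p ^ k)"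
  for p :: "'k::comm_semiring_1 mvpoly"
  by (induction k) (auto intro: homogeneous_mult)

text \<open>The combinations form an ideal that contains every \<open>f i\<close>, and the generated
  ideal is the least such ideal.\<close>

lemma (in polynomial_algebra) genideal_subset_combinations:
  fixes n :: nat
  assumes f: "\<And>i. i < n \<Longrightarrow> f i \<in> polys N" and p: "p \<in> Idl {f i |i. i < n}"
  shows "\<exists>g. (\<forall>i<n. g i \<in> polys N) \<and> p = (\<Sum>i<n. g i * f i)"
proof -
  define J where "J = {\<Sum>i<n. g i * f i |g. \<forall>i<n. g i \<in> polys N}"
  have JI: "(\<Sum>i<n. g i * f i) \<in> J" if "\<And>i. i < n \<Longrightarrow> g i \<in> polys N" for g
    using that by (auto simp: J_def)
  have J_mult: "x * p \<in> J" if x: "x \<in> polys N" and p: "p \<in> J" for x p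
  proof -
    obtain g where g: "\<And>i. i < n \<Longrightarrow> g i \<in> polys N" "p = (\<Sum>i<n. g i * f i)"
      using p by (auto simp: J_def)
    then have "x * p = (\<Sum>i<n. (x * g i) * f i)"
      by (simp add: sum_distrib_left mult.assoc)
    with x g(1) JI[of "\<lambda>i. x * g i"] show ?thesis by auto
  qed
  have J_mult_right: "p * x \<in> J" if "x \<in> polys N" "p \<in> J" for x p
    using J_mult[OF that] by (simp add: mult.commute)
  have J_add: "p + q \<in> J" if pq: "p \<in> J" "q \<in> J" for p q
  proof -
    obtain g h where "\<And>i. i < n \<Longrightarrow> g i \<in> polys N" "p = (\<Sum>i<n. g i * f i)"
      "\<And>i. i < n \<Longrightarrow> h i \<in> polys N" "q = (\<Sum>i<n. h i * f i)"
      using pq by (auto simp: J_def)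
    with JI[of "\<lambda>i. g i + h i"] show ?thesis
      by (auto simp: sum.distrib distrib_right)
  qed
  have J_sub: "J \<subseteq> polys N"
    using f by (auto simp: J_def intro!: polys_sum)
  have J_zero: "0 \<in> J"
    using JI[of "\<lambda>_. 0"] by simp
  have J_uminus: "- p \<in> J" if "p \<in> J" for p
    using J_mult[of "- 1" p] that by (simp add: polys_uminus)
  have ring: "ring R" by (rule cring.axioms(1)[OF is_cring])
  have "ideal J R"
  proof (rule idealI)
    show "ring R" by (rule ring)
    show "subgroup J (add_monoid R)"
    proof (rule M.add.subgroupI)
      fix a assume "a \<in> J"
      moreover from this J_sub have "\<ominus> a = - a"
        by (intro M.minus_equality) (auto simp: polys_uminus)
      ultimately show "\<ominus> a \<in> J" using J_uminus by simp
    qed (use J_sub J_zero J_add in auto)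
  qed (use J_mult J_mult_right in auto)
  moreover have "{f i |i. i < n} \<subseteq> J"
  proof safe
    fix i assume "i < n"
    moreover have "f i = (\<Sum>j<n. (if j = i then 1 else 0) * f j)"
    proof -
      have "(\<Sum>j<n. (if j = i then 1 else 0) * f j) = (\<Sum>j<n. if j = i then f j else 0)"
        by (intro sum.cong) auto
      also have "\<dots> = f i"
        using \<open>i < n\<close> by (subst sum.delta) auto
      finally show ?thesis by (rule sym)
    qed
    ultimately show "f i \<in> J"
      using JI[of "\<lambda>j. if j = i then 1 else 0"] by simp
  qed
  ultimately have "Idl {f i |i. i < n} \<subseteq> J"
    by (rule ring.genideal_minimal[OF ring])
  with p show ?thesis by (auto simp: J_def)
qed

text \<open>The powers of \<open>var j\<close> are dependent modulo the Jacobian ideal. The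
  generators of that ideal are forms of degree \<open>d - 1\<close>, so one homogeneous component of
  the relation is again a relation; it contains a single power, and its coefficients can be taken to
  be forms.\<close>

lemma potential_power:
  fixes \<Omega> :: "'k::field mvpoly"
  assumes pot: "is_potential N d \<Omega>" and j: "j < N"
  shows "\<exists>M h c. d - 1 \<le> M \<and> c \<noteq> 0 \<and> (\<forall>i<N. h i \<in> polys N \<and> homogeneous (M - (d - 1)) (h i)) \<and>
    const c * var j ^ M = (\<Sum>i<N. h i * partial_deriv i \<Omega>)"
proof -
  let ?R = "poly_alg N :: ('k, 'k mvpoly) module"
  let ?I = "Idl\<^bsub>?R\<^esub> {partial_deriv i \<Omega> |i. i < N}"
  define t where "t = (var j :: 'k mvpoly)"
  define e where "e = d - 1"
  have \<Omega>: "\<Omega> \<in> polys N" "homogeneous d \<Omega>"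
    and fd: "vectorspace.fin_dim class_ring (quot_alg ?R ?I)"
    using pot by (auto simp: is_potential_def)
  interpret R: polynomial_algebra N ?R by (rule polynomial_algebra_poly_alg)
  have "ideal ?I ?R"
    by (rule ring.genideal_ideal[OF cring.axioms(1)[OF R.is_cring]]) (use \<Omega> in auto)
  then interpret Q: polynomial_quotient N ?R ?I
    by (simp add: polynomial_quotient_def R.polynomial_algebra_axioms)
  have t: "t \<in> polys N" using j by (auto simp: t_def)
  have ht: "homogeneous k (t ^ k)" for k
    using homogeneous_power[OF homogeneous_var, of k j] by (simp add: t_def)
  obtain B c k where B: "finite B" "k \<in> B" "c k \<noteq> 0"
    and rel: "(\<Sum>l\<in>B. const (c l) * t ^ l) \<in> ?I"
    using Q.fin_dim_powers_dependent[OF fd t] by blast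
  obtain g where g: "\<forall>i<N. g i \<in> polys N"
    and eq: "(\<Sum>l\<in>B. const (c l) * t ^ l) = (\<Sum>i<N. g i * partial_deriv i \<Omega>)"
    using R.genideal_subset_combinations[of N "\<lambda>i. partial_deriv i \<Omega>", OF _ rel] \<Omega>
    by blast
  have h\<Omega>: "homogeneous e (partial_deriv i \<Omega>)" for i
    unfolding e_def by (rule homogeneous_partial_deriv[OF \<Omega>(2)])
  \<comment> \<open>After multiplication by \<open>t ^ e\<close>, with \<open>e = d - 1\<close>, the
    term \<open>c k\<close> sits in degree \<open>k + e\<close>, and there the coefficients
    contribute exactly their components of degree \<open>k\<close>. Thus \<open>M = k + e\<close>
    and \<open>M - (d - 1) = k\<close> without truncation.\<close>
  define h where "h i = part (\<lambda>m. mdeg m = k) (t ^ e * g i)" for i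
  define r where "r i = part (\<lambda>m. mdeg m \<noteq> k) (t ^ e * g i)" for i
  have split: "t ^ e * g i = h i + r i" for i
    unfolding h_def r_def by (rule part_split[symmetric])
  \<comment> \<open>\<open>p\<close> is the component of degree \<open>k + e\<close> of the shifted
    relation and \<open>q\<close> is everything else.\<close>
  define p where "p = const (c k) * t ^ (k + e) - (\<Sum>i<N. h i * partial_deriv i \<Omega>)"
  define q where
    "q = (\<Sum>l\<in>B - {k}. const (c l) * t ^ (l + e)) - (\<Sum>i<N. r i * partial_deriv i \<Omega>)"
  have "p + q = (\<Sum>l\<in>B. const (c l) * t ^ (l + e)) - (\<Sum>i<N. (t ^ e * g i) * partial_deriv i \<Omega>)"
    using B by (simp add: p_def q_def split distrib_right sum.distrib sum.remove)
  also have "\<dots> = t ^ e * ((\<Sum>l\<in>B. const (c l) * t ^ l) - (\<Sum>i<N. g i * partial_deriv i \<Omega>))"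
    by (simp add: right_diff_distrib sum_distrib_left power_add mult_ac)
  finally have "p + q = 0" by (simp add: eq)
  moreover have ct: "homogeneous l (const a * t ^ l)" for l a
    using homogeneous_mult[OF homogeneous_const ht[of l], of a] by simp
  have "homogeneous (k + e) p"
    unfolding p_def diff_conv_add_uminus h_def
    by (intro homogeneous_add homogeneous_uminus homogeneous_sum homogeneous_mult ct h\<Omega>
        homogeneous_part)
  moreover have "avoids_degree (k + e) q"
    unfolding q_def r_def
    by (intro avoids_degree_diff avoids_degree_sum avoids_degree_mult h\<Omega> avoids_degree_part
        homogeneous_avoids_degree[OF ct]) auto
  ultimately have "p = 0"
    by (rule homogeneous_add_avoids_degree_eq_zero)
  then have "const (c k) * t ^ (k + e) = (\<Sum>i<N. h i * partial_deriv i \<Omega>)"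
    by (simp add: p_def)
  moreover have "h i \<in> polys N" if "i < N" for i
    using that g t by (auto simp: h_def intro!: polys_part)
  ultimately show ?thesis
    using B(3) by (intro exI[of _ "k + e"] exI[of _ h] exI[of _ "c k"])
      (auto simp: e_def t_def h_def homogeneous_part)
qed

section \<open>Jacobian determinants as brackets of polynomials\<close>

definition jac :: "nat \<Rightarrow> 'k::field mvpoly \<Rightarrow> 'k mvpoly list \<Rightarrow> 'k mvpoly" where
  "jac n \<Omega> fs = det (mat (n + 1) (n + 1) (\<lambda>(i, j). partial_deriv j ((fs @ [\<Omega>]) ! i)))"

lemma bracket_A_alg: "bracket (A_alg n \<Omega>) fs = jac n \<Omega> fs"
  by (simp add: A_alg_def with_bracket_def jac_def)

text \<open>The cofactors along row \<open>i\<close> do not see that row. In each slot the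
  determinant is therefore a first order differential operator with fixed coefficients, which yields
  additivity and the Leibniz rule at once.\<close>

lemma jac_row_expansion:
  assumes "length fs = n" "i < n"
  shows "\<exists>C. \<forall>x. jac n \<Omega> (fs[i := x]) = (\<Sum>j<n+1. partial_deriv j x * C j)"
proof (intro exI allI)
  fix x
  let ?M = "\<lambda>fs. mat (n + 1) (n + 1) (\<lambda>(i, j). partial_deriv j ((fs @ [\<Omega>]) ! i))"
  have "mat_delete (?M (fs[i := x])) i j = mat_delete (?M fs) i j" for j
    using assms
    by (intro eq_matI) (auto simp: mat_delete_def nth_append nth_list_update)
  then have "cofactor (?M (fs[i := x])) i j = cofactor (?M fs) i j" for j
    by (simp add: cofactor_def)
  then show "jac n \<Omega> (fs[i := x]) = (\<Sum>j<n+1. partial_deriv j x * cofactor (?M fs) i j)"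
    unfolding jac_def using assms
    by (subst laplace_expansion_row[of _ "n + 1" i]) (auto simp: nth_append intro!: sum.cong)
qed

lemma jac_add:
  assumes "length fs = n" "i < n"
  shows "jac n \<Omega> (fs[i := x + y]) = jac n \<Omega> (fs[i := x]) + jac n \<Omega> (fs[i := y])"
proof -
  obtain C where C: "\<And>x. jac n \<Omega> (fs[i := x]) = (\<Sum>j<n+1. partial_deriv j x * C j)"
    using jac_row_expansion[OF assms, of \<Omega>] by blast
  show ?thesis
    unfolding C by (simp only: partial_deriv_add distrib_right sum.distrib)
qed

lemma jac_mult:
  assumes "length fs = n" "i < n"
  shows "jac n \<Omega> (fs[i := x * y]) = x * jac n \<Omega> (fs[i := y]) + y * jac n \<Omega> (fs[i := x])"
proof -
  obtain C where C: "\<And>x. jac n \<Omega> (fs[i := x]) = (\<Sum>j<n+1. partial_deriv j x * C j)"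
    using jac_row_expansion[OF assms, of \<Omega>] by blast
  show ?thesis
    unfolding C
    by (simp only: partial_deriv_mult distrib_right sum.distrib sum_distrib_left mult.assoc)
qed

text \<open>Differentiation forgets the constant, and then rows \<open>i\<close> and
  \<open>n\<close> agree. This is what lets the bracket descend to the quotient by
  \<open>\<Omega> - const \<xi>\<close>.\<close>

lemma jac_potential_eq_zero:
  assumes "length fs = n" "i < n"
  shows "jac n \<Omega> (fs[i := \<Omega> - const \<xi>]) = 0"
proof -
  obtain C where C: "\<And>x. jac n \<Omega> (fs[i := x]) = (\<Sum>j<n+1. partial_deriv j x * C j)"
    using jac_row_expansion[OF assms, of \<Omega>] by blast
  have "jac n \<Omega> (fs[i := \<Omega> - const \<xi>]) = jac n \<Omega> (fs[i := \<Omega>])"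
    unfolding C by (simp only: partial_deriv_diff partial_deriv_const diff_zero)
  also have "\<dots> = 0"
    unfolding jac_def using assms
    by (intro det_identical_rows[of _ "n + 1" i n])
      (auto simp: row_def nth_append intro!: eq_vecI)
  finally show ?thesis .
qed

lemma jac_closed:
  assumes "length fs = n" "set fs \<subseteq> polys N" "\<Omega> \<in> polys N"
  shows "jac n \<Omega> fs \<in> polys N"
proof -
  have "(fs @ [\<Omega>]) ! i \<in> polys N" if "i < n + 1" for i
    using that assms nth_mem[of i fs] by (auto simp: nth_append less_Suc_eq)
  then show ?thesis
    unfolding jac_def
    by (subst det_def'[of _ "n + 1"])
      (auto intro!: polys_sum polys_mult polys_prod polys_partial_deriv
        simp: sign_def polys_uminus permutes_in_image)
qed

text \<open>The first \<open>n\<close> rows consist of constants and the last one of forms of degree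
  \<open>d - 1\<close>; each term of the determinant takes one entry from every row.\<close>

lemma jac_vars_homogeneous:
  assumes "homogeneous d \<Omega>" "length is = n"
  shows "homogeneous (d - 1) (jac n \<Omega> (map var is))"
proof -
  let ?M = "mat (n + 1) (n + 1) (\<lambda>(i, j). partial_deriv j ((map var is @ [\<Omega>]) ! i))"
  have entry: "homogeneous (if i < n then 0 else d - 1) (?M $$ (i, j))" if "i < n + 1" "j < n + 1" for i j
    using that assms
      homogeneous_partial_deriv[OF assms(1)]
    by (auto simp: nth_append partial_deriv_var)
  have "homogeneous (0 + (d - 1)) (signof p * (\<Prod>i = 0..<n+1. ?M $$ (i, p i)))"
    if p: "p permutes {0..<n+1}" for p
  proof (rule homogeneous_mult)
    show "homogeneous 0 (signof p :: 'a mvpoly)"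
      by (auto simp: sign_def intro: homogeneous_uminus)
    have "homogeneous (\<Sum>i = 0..<n+1. if i < n then 0 else d - 1) (\<Prod>i = 0..<n+1. ?M $$ (i, p i))"
      using permutes_in_image[OF p] by (intro homogeneous_prod entry) auto
    moreover have "(\<Sum>i = 0..<n+1. if i < n then 0 else d - 1) = d - 1"
      by simp
    ultimately show "homogeneous (d - 1) (\<Prod>i = 0..<n+1. ?M $$ (i, p i))"
      by simp
  qed
  then show ?thesis
    unfolding jac_def by (subst det_def'[of _ "n + 1"]) (auto intro!: homogeneous_sum)
qed

text \<open>The list runs through all variables except \<open>var i\<close>. In the expansion along
  the row of \<open>\<Omega>\<close>, the minor at column \<open>i\<close> is the identity matrix,
  and the minor at any other column has a zero row.\<close>

lemma jac_omit_var:
  assumes i: "i < n + 1"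
  shows "jac n \<Omega> (map (\<lambda>r. var (if r < i then r else Suc r)) [0..<n])
    = (- 1) ^ (n + i) * partial_deriv i \<Omega>"
proof -
  let ?fs = "map (\<lambda>r. var (if r < i then r else Suc r)) [0..<n]"
  define M where "M = mat (n + 1) (n + 1) (\<lambda>(i, j). partial_deriv j ((?fs @ [\<Omega>]) ! i))"
  have del: "mat_delete M n j $$ (r, c) =
      (if (if c < j then c else Suc c) = (if r < i then r else Suc r) then 1 else 0)"
    if "r < n" "c < n" for j r c
    using that by (simp add: M_def mat_delete_def nth_append partial_deriv_var)
  have dims: "mat_delete M n j \<in> carrier_mat n n" for j
    by (simp add: M_def mat_delete_def)
  have "mat_delete M n i = 1\<^sub>m n"
    using dims[of i] by (intro eq_matI) (auto simp: del)
  then have eq: "det (mat_delete M n i) = 1" by simp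
  have neq: "det (mat_delete M n j) = 0" if j: "j < n + 1" "j \<noteq> i" for j
  proof -
    \<comment> \<open>Row \<open>r\<close> is that of \<open>var j\<close>; its only nonzero entry
      stood in the deleted column \<open>j\<close>.\<close>
    define r where "r = (if j < i then j else j - 1)"
    have r: "r < n" using j i by (auto simp: r_def)
    have "mat_delete M n j $$ (r, c) = 0" if "c < n" for c
      using that r j by (subst del) (auto simp: r_def split: if_splits)
    then have zero: "(\<Prod>s = 0..<n. mat_delete M n j $$ (s, p s)) = 0" if "p permutes {0..<n}" for p
      using r permutes_in_image[OF that, of r] by (intro prod_zero) (auto intro!: bexI[of _ r])
    show ?thesis
      by (subst det_def'[OF dims]) (auto simp: zero intro!: sum.neutral)
  qed
  have row: "M $$ (n, j) = partial_deriv j \<Omega>" if "j < n + 1" for j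
    using that by (simp add: M_def nth_append)
  have "jac n \<Omega> ?fs = (\<Sum>j<n+1. M $$ (n, j) * cofactor M n j)"
    unfolding jac_def M_def[symmetric]
    by (rule laplace_expansion_row[of _ "n + 1"]) (auto simp: M_def)
  also have "\<dots> = (\<Sum>j<n+1. if j = i then (- 1) ^ (n + i) * partial_deriv i \<Omega> else 0)"
    by (intro sum.cong refl) (auto simp: cofactor_def eq neq row)
  also have "\<dots> = (- 1) ^ (n + i) * partial_deriv i \<Omega>"
    using i by simp
  finally show ?thesis .
qed

section \<open>The algebra of a potential\<close>

lemma listset_iff: "xs \<in> listset As \<longleftrightarrow> list_all2 (\<in>) xs As"
  by (induction As arbitrary: xs) (auto simp: set_Cons_def list_all2_Cons2)

locale potential_quotient =
  fixes n :: nat and \<Omega> :: "'k::field mvpoly" and \<xi> :: 'k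
  assumes \<Omega>: "\<Omega> \<in> polys (n + 1)"
begin

definition W :: "'k mvpoly" where "W = \<Omega> - const \<xi>"

lemma W: "W \<in> polys (n + 1)"
  using \<Omega> by (auto simp: W_def)

sublocale A: polynomial_algebra "n + 1" "A_alg n \<Omega>"
  by (rule polynomial_algebra_A_alg)

sublocale Q: polynomial_quotient "n + 1" "A_alg n \<Omega>" "PIdl\<^bsub>A_alg n \<Omega>\<^esub> W"
proof -
  have "ideal (PIdl\<^bsub>A_alg n \<Omega>\<^esub> W) (A_alg n \<Omega>)"
    by (rule cring.cgenideal_ideal[OF A.is_cring]) (simp add: W del: One_nat_def)
  then show "polynomial_quotient (n + 1) (A_alg n \<Omega>) (PIdl\<^bsub>A_alg n \<Omega>\<^esub> W)"
    using A.polynomial_algebra_axioms unfolding polynomial_quotient_def by blast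
qed

abbreviation I :: "'k mvpoly set" where "I \<equiv> PIdl\<^bsub>A_alg n \<Omega>\<^esub> W"

lemma mem_I_iff: "p \<in> I \<longleftrightarrow> (\<exists>h\<in>polys (n + 1). p = h * W)"
  by (auto simp: cgenideal_def)

text \<open>Write \<open>x = y + h * W\<close>. The bracket kills \<open>W\<close> in slot
  \<open>i\<close>, so by the Leibniz rule the difference is a multiple of \<open>W\<close>.\<close>

lemma jac_step:
  assumes fs: "length fs = n" "set fs \<subseteq> polys (n + 1)" and i: "i < n"
    and xy: "x - y \<in> I"
  shows "jac n \<Omega> (fs[i := x]) - jac n \<Omega> (fs[i := y]) \<in> I"
proof -
  obtain h where h: "h \<in> polys (n + 1)" "x - y = h * W"
    using xy by (auto simp: mem_I_iff)
  have "jac n \<Omega> (fs[i := x]) = jac n \<Omega> (fs[i := y + h * W])"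
    using h(2) by (metis add_diff_cancel_left' diff_add_cancel add.commute)
  also have "\<dots> = jac n \<Omega> (fs[i := y]) + jac n \<Omega> (fs[i := h]) * W"
    using jac_potential_eq_zero[OF fs(1) i, of \<Omega> \<xi>]
    by (simp add: jac_add jac_mult fs(1) i flip: W_def)
  finally show ?thesis
    using h(1) fs \<Omega> unfolding mem_I_iff
    by (intro bexI[of _ "jac n \<Omega> (fs[i := h])"])
      (auto intro!: jac_closed dest: set_update_subset_insert[THEN subsetD])
qed

lemma jac_congruent:
  assumes xs: "length xs = n" "set xs \<subseteq> polys (n + 1)"
    and ys: "length ys = n" "set ys \<subseteq> polys (n + 1)"
    and xy: "\<And>i. i < n \<Longrightarrow> xs ! i - ys ! i \<in> I"
  shows "jac n \<Omega> xs - jac n \<Omega> ys \<in> I"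
proof -
  \<comment> \<open>The arguments are exchanged one slot at a time, through lists that agree with
    \<open>ys\<close> in the first \<open>k\<close> slots and with \<open>xs\<close> in the
    rest.\<close>
  have "jac n \<Omega> xs - jac n \<Omega> (take k ys @ drop k xs) \<in> I" if "k \<le> n" for k
    using that
  proof (induction k)
    case 0
    then show ?case by (simp add: Q.I_zero)
  next
    case (Suc k)
    let ?zs = "take k ys @ drop k xs"
    have len: "length ?zs = n" using xs ys Suc.prems by simp
    have sub: "set ?zs \<subseteq> polys (n + 1)"
      using xs(2) ys(2) set_take_subset[of k ys] set_drop_subset[of k xs] by auto
    have 1: "?zs[k := xs ! k] = ?zs"
      using xs ys Suc.prems by (simp add: nth_append list_update_same_conv)
    have 2: "?zs[k := ys ! k] = take (Suc k) ys @ drop (Suc k) xs"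
      using xs ys Suc.prems
      by (intro nth_equalityI) (auto simp: nth_append nth_list_update less_Suc_eq)
    have "jac n \<Omega> ?zs - jac n \<Omega> (take (Suc k) ys @ drop (Suc k) xs) \<in> I"
      using jac_step[OF len sub, of k "xs ! k" "ys ! k"] xy[of k] Suc.prems
      unfolding 1 2 by simp
    from Q.I_add[OF Suc.IH this] Suc.prems show ?case by simp
  qed
  from this[of n] show ?thesis using xs ys by simp
qed

abbreviation P :: "('k, 'k mvpoly set) nambu" where "P \<equiv> P_alg n \<Omega> \<xi>"

lemma P_eq: "P = quot_nambu (A_alg n \<Omega>) I"
  by (simp add: P_alg_def W_def)

lemma P_fields:
  "carrier P = Q.proj ` polys (n + 1)" "mult P = mult Q.Q" "one P = one Q.Q" "zero P = Q.proj 0"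
  "add P = add Q.Q" "smult P = smult Q.Q"
  using Q.carrier_Q Q.proj_hom(4)[of 0 0]
  by (simp_all add: P_eq quot_nambu_def with_bracket_def)

lemma proj_hom: "Q.proj \<in> alg_hom (poly_alg (n + 1)) P"
proof -
  interpret pa: polynomial_algebra "n + 1" "poly_alg (n + 1) :: ('k, 'k mvpoly) module"
    by (rule polynomial_algebra_poly_alg)
  show ?thesis
    using Q.proj_alg_hom
    unfolding alg_hom_def Ring.ring_hom_def P_fields Q.carrier_Q A.carrier_R A.mult_R A.one_R
      A.add_R A.smult_R pa.carrier_R pa.mult_R pa.one_R pa.add_R pa.smult_R .
qed

lemma proj_eq_zero_iff:
  "p \<in> polys (n + 1) \<Longrightarrow> Q.proj p = \<zero>\<^bsub>P\<^esub> \<longleftrightarrow> (\<exists>h\<in>polys (n + 1). p = h * (\<Omega> - const \<xi>))"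
  using Q.proj_eq_iff[of p 0] unfolding P_fields(4) W_def[symmetric]
  by (simp add: mem_I_iff del: One_nat_def)

text \<open>The bracket of cosets is a union over all choices of representatives. All choices give
  the same coset by \<open>jac_congruent\<close>, and \<open>fs\<close> is one of them.\<close>

lemma bracket_P:
  assumes fs: "length fs = n" "set fs \<subseteq> polys (n + 1)"
  shows "bracket P (map Q.proj fs) = Q.proj (jac n \<Omega> fs)"
proof -
  have "Q.proj (jac n \<Omega> xs) = Q.proj (jac n \<Omega> fs)" if "xs \<in> listset (map Q.proj fs)" for xs
  proof -
    have len: "length xs = n" and mem: "\<And>i. i < n \<Longrightarrow> xs ! i \<in> Q.proj (fs ! i)"
      using that fs by (auto simp: listset_iff list_all2_conv_all_nth)
    have mem': "xs ! i \<in> polys (n + 1) \<and> xs ! i - fs ! i \<in> I" if "i < n" for i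
    proof -
      have "fs ! i \<in> polys (n + 1)"
        using that fs by (metis nth_mem subsetD)
      then show ?thesis
        using mem[OF that] Q.mem_proj_iff[of "fs ! i" "xs ! i"] by blast
    qed
    then have sub: "set xs \<subseteq> polys (n + 1)"
      using len by (auto simp: in_set_conv_nth)
    have "jac n \<Omega> xs - jac n \<Omega> fs \<in> I"
      by (rule jac_congruent) (use len sub mem' fs in auto)
    then show ?thesis
      using Q.proj_eq_iff[of "jac n \<Omega> xs" "jac n \<Omega> fs"] jac_closed[OF len sub \<Omega>]
        jac_closed[OF fs \<Omega>] by simp
  qed
  moreover have "fs \<in> listset (map Q.proj fs)"
  proof -
    have "p \<in> Q.proj p" if "p \<in> polys (n + 1)" for p
      using that Q.mem_proj_iff[of p p] Q.I_zero by simp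
    then show ?thesis
      using fs(2) unfolding listset_iff list_all2_map2 list_all2_same by blast
  qed
  ultimately have "(\<Union>xs \<in> listset (map Q.proj fs). Q.proj (jac n \<Omega> xs)) = Q.proj (jac n \<Omega> fs)"
    by (metis (no_types, lifting) SUP_eq_const empty_iff)
  then show ?thesis
    by (simp add: P_eq quot_nambu_def with_bracket_def bracket_A_alg)
qed

end

section \<open>Valuations at a point of the potential\<close>

locale nambu_valuation = nambu_poisson_field n K
  for n and K :: "('k::field, 'b, 'm) nambu_scheme" (structure) +
  fixes w :: int and \<nu> :: "'b \<Rightarrow> int extended"
  assumes valuation: "is_valuation n w K \<nu>"
begin

lemma nu_zero: "\<nu> \<zero> = \<infinity>"
  using valuation by (auto simp: is_valuation_def)

lemma nu_not_Minf: "x \<in> carrier K \<Longrightarrow> \<nu> x \<noteq> -\<infinity>"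
  using valuation by (auto simp: is_valuation_def)

lemma nu_mult: "x \<in> carrier K \<Longrightarrow> y \<in> carrier K \<Longrightarrow> \<nu> (x \<otimes> y) = \<nu> x + \<nu> y"
  using valuation by (auto simp: is_valuation_def)

lemma nu_scalar: "c \<noteq> 0 \<Longrightarrow> \<nu> (c \<odot> \<one>) = Fin 0"
  using valuation by (auto simp: is_valuation_def zero_extended_def)

lemma nu_one: "\<nu> \<one> = Fin 0"
  using nu_scalar[of 1] by (simp add: smult_one[simplified])

lemma Fin_le_nu_scalar: "Fin 0 \<le> \<nu> (c \<odot> \<one>)"
  by (cases "c = 0") (simp_all add: nu_scalar nu_zero smult_l_null[simplified])

lemma Fin_le_nu_add:
  assumes "x \<in> carrier K" "y \<in> carrier K" "Fin k \<le> \<nu> x" "Fin k \<le> \<nu> y"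
  shows "Fin k \<le> \<nu> (x \<oplus> y)"
proof -
  have "min (\<nu> x) (\<nu> y) \<le> \<nu> (x \<oplus> y)"
    using valuation assms(1,2) by (auto simp: is_valuation_def)
  with assms(3,4) show ?thesis by (metis min.bounded_iff order_trans)
qed

lemma Fin_le_nu_mult:
  assumes "x \<in> carrier K" "y \<in> carrier K" "Fin k \<le> \<nu> x" "Fin l \<le> \<nu> y"
  shows "Fin (k + l) \<le> \<nu> (x \<otimes> y)"
  using add_mono[OF assms(3,4)] assms(1,2) by (simp add: nu_mult)

lemma nu_bracket:
  assumes "length bs = n" "set bs \<subseteq> carrier K"
  shows "Fin (- w) + (\<Sum>b\<leftarrow>bs. \<nu> b) \<le> \<nu> (\<lbrace>bs\<rbrace>)"
  using valuation assms by (auto simp: is_valuation_def)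

end

text \<open>A \<open>K\<close>-valued point of affine \<open>N\<close>-space. The points in use come
  from a morphism out of \<open>P_alg n \<Omega> 1\<close>, from the polynomial ring inside the Weyl
  field, and from \<open>P_alg n \<Omega> 0\<close> inside its fraction field.\<close>

locale polynomial_point = nambu_poisson_field n K
  for n and K :: "('k::field, 'b, 'm) nambu_scheme" (structure) +
  fixes N :: nat and \<theta> :: "'k mvpoly \<Rightarrow> 'b"
  assumes theta: "\<theta> \<in> alg_hom (poly_alg N) K"
begin

lemma theta_closed [intro]: "p \<in> polys N \<Longrightarrow> \<theta> p \<in> carrier K"
  using theta by (auto simp: alg_hom_def Ring.ring_hom_def poly_alg_def)

lemma theta_add: "p \<in> polys N \<Longrightarrow> q \<in> polys N \<Longrightarrow> \<theta> (p + q) = \<theta> p \<oplus> \<theta> q"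
  using theta by (auto simp: alg_hom_def Ring.ring_hom_def poly_alg_def)

lemma theta_mult: "p \<in> polys N \<Longrightarrow> q \<in> polys N \<Longrightarrow> \<theta> (p * q) = \<theta> p \<otimes> \<theta> q"
  using theta by (auto simp: alg_hom_def Ring.ring_hom_def poly_alg_def)

lemma theta_one: "\<theta> 1 = \<one>"
  using theta by (auto simp: alg_hom_def Ring.ring_hom_def poly_alg_def)

lemma theta_smult: "p \<in> polys N \<Longrightarrow> \<theta> (const c * p) = c \<odot> \<theta> p"
  using theta by (auto simp: alg_hom_def poly_alg_def)

lemma theta_const: "\<theta> (const c) = c \<odot> \<one>"
  using theta_smult[of 1 c] by (simp add: theta_one)

lemma theta_zero: "\<theta> 0 = \<zero>"
  using theta_smult[of 0 0] theta_closed[of 0] smult_l_null[of "\<theta> 0"] by simp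

lemma theta_uminus: "p \<in> polys N \<Longrightarrow> \<theta> (- p) = \<ominus> \<theta> p"
  using theta_add[of "- p" p] theta_closed[of p] theta_closed[of "- p"]
  by (metis M.minus_equality add.left_inverse polys_uminus theta_zero)

lemma theta_single:
  assumes "Poly_Mapping.keys m \<subseteq> {..<N}"
  shows "\<theta> (Poly_Mapping.single m c) = c \<odot> \<theta> (Poly_Mapping.single m 1)"
  using theta_smult[OF polys_single[OF assms], of c 1] by (simp add: const_def mult_single)

lemma theta_var_monomial:
  assumes "Poly_Mapping.keys (Poly_Mapping.single i 1 + m) \<subseteq> {..<N}"
  shows "i < N" "Poly_Mapping.keys m \<subseteq> {..<N}"
    "\<theta> (Poly_Mapping.single (Poly_Mapping.single i 1 + m) 1)
      = \<theta> (var i) \<otimes> \<theta> (Poly_Mapping.single m 1)"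
proof -
  have "Poly_Mapping.keys (Poly_Mapping.single i 1 + m) = insert i (Poly_Mapping.keys m)"
    by (auto simp: in_keys_iff lookup_add lookup_single when_def split: if_splits)
  with assms show *: "i < N" "Poly_Mapping.keys m \<subseteq> {..<N}" by auto
  then show "\<theta> (Poly_Mapping.single (Poly_Mapping.single i 1 + m) 1)
      = \<theta> (var i) \<otimes> \<theta> (Poly_Mapping.single m 1)"
    using theta_mult[OF polys_var[OF *(1)] polys_single[OF *(2), of 1]]
    by (simp add: var_def mult_single)
qed

text \<open>The conditions on \<open>P\<close> say that it defines a linear subspace of
  \<open>K\<close>, so membership of \<open>\<theta> p\<close> can be tested on the monomials of
  \<open>p\<close>.\<close>

lemma theta_monomial_induct:
  assumes p: "p \<in> polys N"
    and zero: "P \<zero>"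
    and add: "\<And>x y. x \<in> carrier K \<Longrightarrow> y \<in> carrier K \<Longrightarrow> P x \<Longrightarrow> P y \<Longrightarrow> P (x \<oplus> y)"
    and smult: "\<And>c x. x \<in> carrier K \<Longrightarrow> P x \<Longrightarrow> P (c \<odot> x)"
    and mono: "\<And>m. m \<in> Poly_Mapping.keys p \<Longrightarrow> Poly_Mapping.keys m \<subseteq> {..<N} \<Longrightarrow>
      P (\<theta> (Poly_Mapping.single m 1))"
  shows "P (\<theta> p)"
proof -
  have "p \<in> polys N \<and> P (\<theta> p)"
  proof (induction p rule: poly_mapping_monomial_induct)
    case zero
    then show ?case using assms(2) by (simp add: theta_zero)
  next
    case (single m c)
    then have m: "Poly_Mapping.keys m \<subseteq> {..<N}"
      using p by (auto simp: polys_def)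
    have "P (c \<odot> \<theta> (Poly_Mapping.single m 1))"
      by (rule smult[OF _ mono[OF single m]]) (use m polys_single in blast)
    then show ?case
      using m polys_single by (metis theta_single)
  next
    case (add q r)
    then show ?case
      using assms(3) by (simp add: theta_add polys_add theta_closed)
  qed
  then show ?thesis ..
qed

end

locale valued_point = nambu_valuation n K w \<nu> + polynomial_point n K N \<theta>
  for n and K :: "('k::field, 'b, 'm) nambu_scheme" (structure) and w \<nu> N \<theta>
begin

lemma Fin_le_nu_smult:
  assumes "x \<in> carrier K" "Fin k \<le> \<nu> x"
  shows "Fin k \<le> \<nu> (c \<odot> x)"
proof -
  have "c \<odot> x = (c \<odot> \<one>) \<otimes> x"
    using smult_assoc2[of c \<one> x] assms by simp
  then show ?thesis
    using Fin_le_nu_mult[of "c \<odot> \<one>" x 0 k] Fin_le_nu_scalar assms by simp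
qed

lemma Fin_le_nu_monomial:
  assumes vars: "\<And>j. j < N \<Longrightarrow> Fin k \<le> \<nu> (\<theta> (var j))"
  shows "Poly_Mapping.keys m \<subseteq> {..<N} \<Longrightarrow>
    Fin (int (mdeg m) * k) \<le> \<nu> (\<theta> (Poly_Mapping.single m 1))"
proof (induction m rule: mdeg_induct)
  case zero
  then show ?case by (simp add: theta_one nu_one)
next
  case (var i m)
  note * = theta_var_monomial[OF var.prems]
  have "Fin (k + int (mdeg m) * k) \<le> \<nu> (\<theta> (var i) \<otimes> \<theta> (Poly_Mapping.single m 1))"
    by (rule Fin_le_nu_mult[OF _ _ vars var.IH]) (use * polys_var polys_single in blast)+
  then show ?case
    by (simp only: *(3) mdeg_add mdeg_single) (simp add: distrib_right)
qed

text \<open>A monomial of degree \<open>e\<close> is a product of \<open>e\<close> generators, and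
  its coefficient costs nothing, since constants have value 0 or \<infinity>.\<close>

lemma Fin_le_nu_homogeneous:
  assumes vars: "\<And>j. j < N \<Longrightarrow> Fin k \<le> \<nu> (\<theta> (var j))"
    and p: "p \<in> polys N" "homogeneous e p"
  shows "Fin (int e * k) \<le> \<nu> (\<theta> p)"
proof (rule theta_monomial_induct[OF p(1)])
  fix m assume "m \<in> Poly_Mapping.keys p" "Poly_Mapping.keys m \<subseteq> {..<N}"
  with Fin_le_nu_monomial[OF vars, of m] p(2)
  show "Fin (int e * k) \<le> \<nu> (\<theta> (Poly_Mapping.single m 1))"
    by (auto simp: homogeneous_iff)
qed (auto simp: nu_zero intro: Fin_le_nu_add Fin_le_nu_smult)

lemma nu_theta_power:
  assumes "p \<in> polys N" "\<nu> (\<theta> p) = Fin a"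
  shows "\<nu> (\<theta> (p ^ k)) = Fin (int k * a)"
  by (induction k)
    (use assms in \<open>simp_all add: theta_one nu_one theta_mult polys_power nu_mult theta_closed distrib_right\<close>)

lemma Fin_le_nu_theta_sum:
  assumes "finite A" "\<And>i. i \<in> A \<Longrightarrow> f i \<in> polys N" "\<And>i. i \<in> A \<Longrightarrow> Fin k \<le> \<nu> (\<theta> (f i))"
  shows "Fin k \<le> \<nu> (\<theta> (sum f A))"
  using assms
  by (induction A rule: finite_induct)
    (auto simp: theta_zero nu_zero theta_add polys_sum intro!: Fin_le_nu_add)

end

lemma Fin_le_sum_list:
  fixes f :: "'a \<Rightarrow> int extended"
  assumes "\<And>x. x \<in> set xs \<Longrightarrow> Fin k \<le> f x"
  shows "Fin (int (length xs) * k) \<le> (\<Sum>x\<leftarrow>xs. f x)"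
  using assms
proof (induction xs)
  case (Cons x xs)
  have "Fin k + Fin (int (length xs) * k) \<le> f x + (\<Sum>x\<leftarrow>xs. f x)"
    by (intro add_mono Cons) (use Cons.prems in auto)
  then show ?case by (simp add: distrib_right)
qed (simp add: zero_extended_def)

text \<open>Of the morphism only two traces in \<open>K\<close> are kept: \<open>one\<close>, the
  equation of the hypersurface, and \<open>br\<close>, the brackets in which exactly one generator
  is left out.\<close>

lemma (in valued_point) potential_point_contradiction:
  assumes N: "N = n + 1" and w: "w = - 1"
    and pot: "is_potential (n + 1) d \<Omega>" and d: "d \<ge> n + 1"
    and one: "\<theta> \<Omega> = \<one>"
    and br: "\<And>i. i < n + 1 \<Longrightarrow>
      \<lbrace>map (\<lambda>r. \<theta> (var (if r < i then r else Suc r))) [0..<n]\<rbrace> = \<theta> ((- 1) ^ (n + i) * partial_deriv i \<Omega>)"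
  shows False
proof -
  have \<Omega>: "\<Omega> \<in> polys N" "homogeneous d \<Omega>"
    using pot N by (auto simp: is_potential_def)
  show False
  proof (cases "\<forall>j<N. Fin 1 \<le> \<nu> (\<theta> (var j))")
    case True
    then have "Fin (int d * 1) \<le> \<nu> (\<theta> \<Omega>)"
      by (intro Fin_le_nu_homogeneous \<Omega>) auto
    with d show False by (simp add: one nu_one)
  next
    case False
    \<comment> \<open>A generator may map to zero, so only finite values are collected. The set is
      nonempty: a generator that violates the bound \<open>Fin 1\<close> has a finite value, and
      this value is at most 0.\<close>
    define S where "S = {a. \<exists>j<N. \<nu> (\<theta> (var j)) = Fin a}"
    have "S \<subseteq> (\<lambda>j. case \<nu> (\<theta> (var j)) of Fin a \<Rightarrow> a | _ \<Rightarrow> 0) ` {..<N}"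
      by (force simp: S_def)
    then have fin: "finite S"
      by (rule finite_subset) simp
    obtain j1 where j1: "j1 < N" "\<not> Fin 1 \<le> \<nu> (\<theta> (var j1))"
      using False by auto
    then obtain a where a: "\<nu> (\<theta> (var j1)) = Fin a" "a \<le> 0"
      by (cases "\<nu> (\<theta> (var j1))") (use nu_not_Minf theta_closed polys_var in auto)
    with j1 have aS: "a \<in> S" by (auto simp: S_def)
    define m where "m = Min S"
    have m0: "m \<le> 0"
      using Min_le[OF fin aS] a(2) by (simp add: m_def)
    have "m \<in> S"
      using Min_in[OF fin] aS by (auto simp: m_def)
    then obtain j where j: "j < N" "\<nu> (\<theta> (var j)) = Fin m"
      by (auto simp: S_def)
    have vars: "Fin m \<le> \<nu> (\<theta> (var i))" if "i < N" for i
    proof (cases "\<nu> (\<theta> (var i))")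
      case (Fin b)
      with that have "b \<in> S" by (auto simp: S_def)
      with Fin show ?thesis using Min_le[OF fin] by (auto simp: m_def)
    qed (use that nu_not_Minf theta_closed polys_var in auto)
    have deriv: "Fin (1 + int n * m) \<le> \<nu> (\<theta> (partial_deriv i \<Omega>))" if i: "i < N" for i
    proof -
      \<comment> \<open>The sign of the bracket is removed by multiplying with it once more; as a
        form of degree 0 it has value at least 0.\<close>
      let ?s = "(- 1) ^ (n + i) :: 'k mvpoly"
      let ?bs = "map (\<lambda>r. \<theta> (var (if r < i then r else Suc r))) [0..<n]"
      have pd: "partial_deriv i \<Omega> \<in> polys N" using \<Omega>(1) by auto
      have s: "?s \<in> polys N" "homogeneous 0 ?s"
        using homogeneous_power[OF homogeneous_uminus[OF homogeneous_one], of "n + i"]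
        by (auto simp: polys_uminus polys_power)
      have bs: "x \<in> carrier K \<and> Fin m \<le> \<nu> x" if x: "x \<in> set ?bs" for x
      proof -
        obtain s where s: "s < n" "x = \<theta> (var (if s < i then s else Suc s))"
          using x by auto
        then have "(if s < i then s else Suc s) < N"
          using N by simp
        with s(2) show ?thesis
          using vars theta_closed polys_var by blast
      qed
      then have sub: "set ?bs \<subseteq> carrier K" by blast
      have "Fin (int (length ?bs) * m) \<le> (\<Sum>b\<leftarrow>?bs. \<nu> b)"
        by (rule Fin_le_sum_list) (use bs in blast)
      \<comment> \<open>The summand \<open>Fin 1\<close> is \<open>Fin (- w)\<close>.\<close>
      then have "Fin 1 + Fin (int n * m) \<le> Fin (- w) + (\<Sum>b\<leftarrow>?bs. \<nu> b)"
        unfolding w by (intro add_mono) auto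
      also have "\<dots> \<le> \<nu> (\<lbrace>?bs\<rbrace>)"
        by (rule nu_bracket[OF _ sub]) simp
      also have "\<lbrace>?bs\<rbrace> = \<theta> (?s * partial_deriv i \<Omega>)"
        using br i N by simp
      finally have 1: "Fin (1 + int n * m) \<le> \<nu> (\<theta> (?s * partial_deriv i \<Omega>))"
        by simp
      have 2: "Fin (int 0 * m) \<le> \<nu> (\<theta> ?s)"
        by (rule Fin_le_nu_homogeneous[OF vars s])
      have "Fin (int 0 * m + (1 + int n * m)) \<le> \<nu> (\<theta> ?s \<otimes> \<theta> (?s * partial_deriv i \<Omega>))"
        by (rule Fin_le_nu_mult[OF _ _ 2 1]) (use s pd in auto)
      also have "\<theta> ?s \<otimes> \<theta> (?s * partial_deriv i \<Omega>) = \<theta> (?s * (?s * partial_deriv i \<Omega>))"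
        using s pd by (intro theta_mult[symmetric]) auto
      also have "?s * (?s * partial_deriv i \<Omega>) = partial_deriv i \<Omega>"
        by (simp flip: mult.assoc power_add)
      finally show ?thesis by simp
    qed
    obtain M h c where M: "d - 1 \<le> M" "c \<noteq> 0"
      and h: "\<And>i. i < N \<Longrightarrow> h i \<in> polys N \<and> homogeneous (M - (d - 1)) (h i)"
      and eq: "const c * var j ^ M = (\<Sum>i<N. h i * partial_deriv i \<Omega>)"
      using potential_power[OF pot, of j] j(1) unfolding N by blast
    have "\<nu> (\<theta> (const c * var j ^ M)) = Fin (int M * m)"
      using nu_theta_power[OF polys_var[OF j(1)] j(2), of M] j(1) M(2)
      by (simp add: theta_mult polys_power polys_var nu_mult theta_closed theta_const nu_scalar)
    moreover have "Fin (int (M - (d - 1)) * m + (1 + int n * m))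
      \<le> \<nu> (\<theta> (\<Sum>i<N. h i * partial_deriv i \<Omega>))"
    proof (rule Fin_le_nu_theta_sum)
      fix i assume "i \<in> {..<N}"
      then have i: "i < N" by simp
      show "h i * partial_deriv i \<Omega> \<in> polys N"
        using h[OF i] \<Omega>(1) by auto
      have "\<theta> (h i * partial_deriv i \<Omega>) = \<theta> (h i) \<otimes> \<theta> (partial_deriv i \<Omega>)"
        using h[OF i] \<Omega>(1) by (intro theta_mult) auto
      then show "Fin (int (M - (d - 1)) * m + (1 + int n * m)) \<le> \<nu> (\<theta> (h i * partial_deriv i \<Omega>))"
        using h[OF i] \<Omega>(1) Fin_le_nu_homogeneous[OF vars, of "h i" "M - (d - 1)"] deriv[OF i]
        by (auto intro!: Fin_le_nu_mult)
    qed simp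
    \<comment> \<open>Both sides of the relation for \<open>var j ^ M\<close> have been valued:
      exactly on the left, from below on the right. What remains is
      \<open>1 \<le> (d - 1 - n) * m\<close>, where the first factor is nonnegative and
      \<open>m \<le> 0\<close>.\<close>
    ultimately have "int (M - (d - 1)) * m + (1 + int n * m) \<le> int M * m"
      by (simp add: eq)
    moreover have "int (M - (d - 1)) = int M - int (d - 1)"
      using M(1) by simp
    ultimately have "1 \<le> (int (d - 1) - int n) * m"
      by (simp add: algebra_simps)
    moreover have "(int (d - 1) - int n) * m \<le> 0"
      using d m0 by (intro mult_nonneg_nonpos) auto
    ultimately show False by simp
  qed
qed

section \<open>The valuation of a graded domain\<close>

text \<open>
  The valuation below is the order for \<open>\<sigma> = 1\<close> and \<open>-deg\<close> for \<open>\<sigma> = -1\<close>. The filtration \<open>R\<close> lives on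
  the image of \<open>\<theta>\<close>, \<open>F\<close> is its extension to the field, and \<open>exact k x\<close> says that \<open>x\<close> has value \<open>k\<close>.
\<close>

locale graded_point = polynomial_point n K N \<theta>
  for n and K :: "('k::field, 'b, 'm) nambu_scheme" (structure) and N \<theta> +
  fixes \<sigma> :: int
  assumes sigma: "\<sigma> \<noteq> 0"
    and fractions: "x \<in> carrier K \<Longrightarrow>
      \<exists>a\<in>polys N. \<exists>b\<in>polys N. \<theta> b \<noteq> \<zero> \<and> x \<otimes> \<theta> b = \<theta> a"
    and graded_kernel: "\<lbrakk>h \<in> polys N; r \<in> polys N; homogeneous e h; avoids_degree e r;
      \<theta> (h + r) = \<zero>\<rbrakk> \<Longrightarrow> \<theta> h = \<zero>"
begin

definition wge :: "int \<Rightarrow> 'k mvpoly \<Rightarrow> bool" where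
  "wge k p \<longleftrightarrow> p \<in> polys N \<and> (\<forall>m \<in> Poly_Mapping.keys p. k \<le> \<sigma> * int (mdeg m))"

definition R :: "int \<Rightarrow> 'b set" where
  "R k = \<theta> ` {p. wge k p}"

definition exact :: "int \<Rightarrow> 'b \<Rightarrow> bool" where
  "exact k x \<longleftrightarrow> x \<in> R k \<and> x \<notin> R (k + 1)"

definition F :: "int \<Rightarrow> 'b set" where
  "F k = {x \<in> carrier K. \<exists>y w. exact w y \<and> x \<otimes> y \<in> R (k + w)}"

section \<open>The filtration on the image of the polynomial ring\<close>

lemma wge_polys: "wge k p \<Longrightarrow> p \<in> polys N"
  by (simp add: wge_def)

lemma wge_zero [simp]: "wge k 0"
  by (simp add: wge_def)

lemma wge_add: "wge k p \<Longrightarrow> wge k q \<Longrightarrow> wge k (p + q)"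
  using keys_add[of p q] by (auto simp: wge_def)

lemma wge_mult:
  assumes "wge k p" "wge l q"
  shows "wge (k + l) (p * q)"
  unfolding wge_def
proof (intro conjI ballI)
  show "p * q \<in> polys N" using assms by (auto simp: wge_def)
  fix m assume "m \<in> Poly_Mapping.keys (p * q)"
  then obtain a b where "m = a + b" "a \<in> Poly_Mapping.keys p" "b \<in> Poly_Mapping.keys q"
    using keys_mult[of p q] by blast
  then show "k + l \<le> \<sigma> * int (mdeg m)"
    using assms add_mono[of k "\<sigma> * int (mdeg a)" l "\<sigma> * int (mdeg b)"]
    by (auto simp: wge_def mdeg_add distrib_left)
qed

lemma wge_mono: "wge k p \<Longrightarrow> l \<le> k \<Longrightarrow> wge l p"
  by (force simp: wge_def)

lemma wge_homogeneous: "p \<in> polys N \<Longrightarrow> homogeneous e p \<Longrightarrow> wge (\<sigma> * int e) p"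
  by (simp add: wge_def homogeneous_iff)

lemma wge_avoids_degree: "wge k p \<Longrightarrow> \<sigma> * int e < k \<Longrightarrow> avoids_degree e p"
  by (force simp: wge_def avoids_degree_def)

lemma R_I: "wge k p \<Longrightarrow> \<theta> p \<in> R k"
  by (simp add: R_def)

lemma R_E:
  assumes "x \<in> R k"
  obtains p where "wge k p" "x = \<theta> p"
  using assms by (auto simp: R_def)

lemma R_carrier: "x \<in> R k \<Longrightarrow> x \<in> carrier K"
  by (auto simp: R_def wge_def)

lemma R_zero: "\<zero> \<in> R k"
  unfolding R_def using theta_zero by (intro image_eqI[of _ _ 0]) auto

lemma R_add: "x \<in> R k \<Longrightarrow> y \<in> R k \<Longrightarrow> x \<oplus> y \<in> R k"
  by (metis R_E R_I wge_add wge_polys theta_add)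

lemma R_mult: "x \<in> R k \<Longrightarrow> y \<in> R l \<Longrightarrow> x \<otimes> y \<in> R (k + l)"
proof -
  assume "x \<in> R k" "y \<in> R l"
  then obtain p q where pq: "wge k p" "x = \<theta> p" "wge l q" "y = \<theta> q"
    by (auto elim!: R_E)
  then have "x \<otimes> y = \<theta> (p * q)"
    using theta_mult[of p q] wge_polys by simp
  then show ?thesis
    using R_I[OF wge_mult[OF pq(1,3)]] by simp
qed

lemma R_mono: "x \<in> R k \<Longrightarrow> l \<le> k \<Longrightarrow> x \<in> R l"
  unfolding R_def using wge_mono by blast

lemma R_smult: "x \<in> R k \<Longrightarrow> c \<odot> x \<in> R k"
proof -
  assume "x \<in> R k"
  then obtain p where p: "wge k p" "x = \<theta> p" by (auto simp: R_def)
  have "wge (0 + k) (const c * p)"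
    using wge_homogeneous[OF polys_const homogeneous_const, of c] p(1)
    by (intro wge_mult) auto
  moreover have "c \<odot> x = \<theta> (const c * p)"
    using p wge_polys by (simp add: theta_smult)
  ultimately show ?thesis by (auto simp: R_def)
qed

lemma R_uminus: "x \<in> R k \<Longrightarrow> \<ominus> x \<in> R k"
  using R_smult[of x k "- 1"] R_carrier[of x k] smult_l_minus[of 1 x]
  by (simp add: smult_one[simplified] class_ring_simps)

lemma homogeneous_R: "p \<in> polys N \<Longrightarrow> homogeneous e p \<Longrightarrow> \<theta> p \<in> R (\<sigma> * int e)"
  using wge_homogeneous by (auto simp: R_def)

text \<open>If the element also came from some \<open>s\<close> of larger weight, then
  \<open>h + (r - s)\<close> would lie in the kernel. Its component of degree \<open>e\<close> is
  \<open>h\<close>, so by homogeneity of the kernel \<open>h\<close> would lie there too.\<close>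

lemma exact_leading_form:
  assumes h: "h \<in> polys N" "homogeneous e h" "\<theta> h \<noteq> \<zero>" and r: "wge (\<sigma> * int e + 1) r"
  shows "exact (\<sigma> * int e) (\<theta> (h + r))"
proof -
  have "wge (\<sigma> * int e) (h + r)"
    using wge_homogeneous[OF h(1,2)] wge_mono[OF r] by (intro wge_add) auto
  moreover have "\<theta> (h + r) \<notin> R (\<sigma> * int e + 1)"
  proof
    assume "\<theta> (h + r) \<in> R (\<sigma> * int e + 1)"
    then obtain s where s: "wge (\<sigma> * int e + 1) s" "\<theta> (h + r) = \<theta> s"
      by (auto simp: R_def)
    have polys: "r \<in> polys N" "s \<in> polys N" "r - s \<in> polys N"
      using r s wge_polys by (auto intro!: polys_diff)
    have "h + (r - s) = (h + r) + (- s)" by simp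
    also have "\<theta> \<dots> = \<theta> (h + r) \<oplus> \<theta> (- s)"
      using polys h(1) by (intro theta_add) auto
    also have "\<dots> = \<theta> s \<oplus> (\<ominus> \<theta> s)"
      by (simp only: s(2) theta_uminus[OF polys(2)])
    also have "\<dots> = \<zero>"
      using polys by (simp add: M.r_neg theta_closed)
    finally have "\<theta> (h + (r - s)) = \<zero>" .
    moreover have "avoids_degree e (r - s)"
      using wge_avoids_degree[OF r] wge_avoids_degree[OF s(1)] by (intro avoids_degree_diff) auto
    ultimately have "\<theta> h = \<zero>"
      using graded_kernel[OF h(1) polys(3) h(2)] by blast
    with h(3) show False ..
  qed
  ultimately show ?thesis by (auto simp: exact_def R_def)
qed

lemma leading_form:
  assumes "exact k x"
  obtains e h r where "k = \<sigma> * int e" "h \<in> polys N" "homogeneous e h" "\<theta> h \<noteq> \<zero>"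
    "wge (k + 1) r" "x = \<theta> (h + r)"
proof -
  obtain p where p: "wge k p" "x = \<theta> p"
    using assms by (auto simp: exact_def R_def)
  \<comment> \<open>Equal weight means equal degree because \<open>\<sigma> \<noteq> 0\<close>, so
    the terms of weight \<open>k\<close> make up a single form.\<close>
  define h where "h = part (\<lambda>m. \<sigma> * int (mdeg m) = k) p"
  define r where "r = part (\<lambda>m. \<sigma> * int (mdeg m) \<noteq> k) p"
  have hr: "h + r = p" by (simp add: h_def r_def part_split)
  have polys: "h \<in> polys N" "r \<in> polys N"
    using p(1) by (auto simp: h_def r_def wge_def)
  have r: "wge (k + 1) r"
    using p(1) polys(2) by (force simp: wge_def r_def keys_part)
  have h: "\<theta> h \<noteq> \<zero>"
  proof
    assume "\<theta> h = \<zero>"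
    then have "x = \<theta> r"
      using theta_add[OF polys] p(2) hr polys by (simp add: theta_closed)
    with r assms show False by (auto simp: exact_def R_def)
  qed
  then have "h \<noteq> 0" using theta_zero by auto
  then obtain m where "m \<in> Poly_Mapping.keys h"
    by (metis keys_zero poly_mapping_eqI in_keys_iff lookup_zero)
  then have k: "k = \<sigma> * int (mdeg m)" by (auto simp: h_def keys_part)
  then have "homogeneous (mdeg m) h"
    using sigma by (auto simp: homogeneous_iff h_def keys_part)
  with that k polys h r hr p(2) show ?thesis by metis
qed

lemma exact_carrier: "exact k x \<Longrightarrow> x \<in> carrier K"
  using R_carrier by (auto simp: exact_def)

lemma exact_nonzero: "exact k x \<Longrightarrow> x \<noteq> \<zero>"
  using R_zero by (auto simp: exact_def)

text \<open>The product of the two leading forms is not killed by \<open>\<theta>\<close>, since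
  \<open>K\<close> has no zero divisors, and all remaining products have larger weight.\<close>

lemma exact_mult:
  assumes "exact k x" "exact l y"
  shows "exact (k + l) (x \<otimes> y)"
proof -
  obtain e h r where 1: "k = \<sigma> * int e" "h \<in> polys N" "homogeneous e h" "\<theta> h \<noteq> \<zero>"
    "wge (k + 1) r" "x = \<theta> (h + r)"
    by (rule leading_form[OF assms(1)])
  obtain e' h' r' where 2: "l = \<sigma> * int e'" "h' \<in> polys N" "homogeneous e' h'" "\<theta> h' \<noteq> \<zero>"
    "wge (l + 1) r'" "y = \<theta> (h' + r')"
    by (rule leading_form[OF assms(2)])
  have polys: "r \<in> polys N" "r' \<in> polys N"
    using 1 2 wge_polys by auto
  define s where "s = h * r' + r * h' + r * r'"
  have kl: "k + l = \<sigma> * int (e + e')"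
    by (simp add: 1(1) 2(1) distrib_left)
  have "x \<otimes> y = \<theta> (h * h' + s)"
    using 1(2) 2(2) polys
    by (simp add: 1(6) 2(6) s_def polys_add flip: theta_mult) (simp add: algebra_simps)
  moreover have "exact (\<sigma> * int (e + e')) (\<theta> (h * h' + s))"
  proof (rule exact_leading_form)
    show "h * h' \<in> polys N" "homogeneous (e + e') (h * h')"
      using 1 2 by (auto intro: homogeneous_mult)
    show "\<theta> (h * h') \<noteq> \<zero>"
      using 1 2 by (simp add: theta_mult theta_closed integral_iff)
    have "wge k h" "wge l h'" using 1 2 wge_homogeneous by auto
    then have "wge (k + l + 1) (h * r')" "wge (k + l + 1) (r * h')" "wge (k + l + 1) (r * r')"
      using wge_mult[of k h "l + 1" r'] wge_mult[of "k + 1" r l h'] wge_mult[of "k + 1" r "l + 1" r']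
        wge_mono[of "k + 1 + (l + 1)" "r * r'" "k + l + 1"] 1(5) 2(5)
      by (simp_all add: algebra_simps)
    then show "wge (\<sigma> * int (e + e') + 1) s"
      unfolding s_def kl[symmetric] by (intro wge_add)
  qed
  ultimately show ?thesis by (simp only: kl)
qed

lemma exact_exists:
  assumes "p \<in> polys N" "\<theta> p \<noteq> \<zero>"
  shows "\<exists>k. exact k (\<theta> p)"
  using assms
proof (induction "card (Poly_Mapping.keys p)" arbitrary: p rule: less_induct)
  case less
  have "p \<noteq> 0" using less.prems theta_zero by auto
  then have ne: "Poly_Mapping.keys p \<noteq> {}"
    by simp
  let ?S = "(\<lambda>m. \<sigma> * int (mdeg m)) ` Poly_Mapping.keys p"
  have "Min ?S \<in> ?S"
    by (rule Min_in) (use ne in auto)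
  then obtain m where m: "m \<in> Poly_Mapping.keys p" "Min ?S = \<sigma> * int (mdeg m)"
    by blast
  have min: "\<sigma> * int (mdeg m) \<le> \<sigma> * int (mdeg m')" if "m' \<in> Poly_Mapping.keys p" for m'
    using Min_le[of ?S "\<sigma> * int (mdeg m')"] that m(2) by auto
  define h where "h = part (\<lambda>m'. mdeg m' = mdeg m) p"
  define r where "r = part (\<lambda>m'. mdeg m' \<noteq> mdeg m) p"
  have hr: "h + r = p" by (simp add: h_def r_def part_split)
  have polys: "h \<in> polys N" "r \<in> polys N"
    using less.prems by (auto simp: h_def r_def)
  show ?case
  proof (cases "\<theta> h = \<zero>")
    case True
    then have "\<theta> p = \<theta> r"
      using theta_add[OF polys] hr polys by (simp add: theta_closed)
    moreover have "Poly_Mapping.keys r \<subset> Poly_Mapping.keys p"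
      using m by (auto simp: r_def keys_part)
    ultimately show ?thesis
      using less.hyps[of r] polys less.prems by (simp add: psubset_card_mono)
  next
    case False
    have "wge (\<sigma> * int (mdeg m) + 1) r"
      unfolding wge_def
    proof (intro conjI ballI)
      fix m' assume "m' \<in> Poly_Mapping.keys r"
      then have "m' \<in> Poly_Mapping.keys p" "mdeg m' \<noteq> mdeg m"
        by (auto simp: r_def keys_part)
      then have "\<sigma> * int (mdeg m) \<noteq> \<sigma> * int (mdeg m')" using sigma by simp
      with min[OF \<open>m' \<in> Poly_Mapping.keys p\<close>]
      show "\<sigma> * int (mdeg m) + 1 \<le> \<sigma> * int (mdeg m')" by linarith
    qed (rule polys)
    then have "exact (\<sigma> * int (mdeg m)) (\<theta> (h + r))"
      using polys False by (intro exact_leading_form) (auto simp: h_def homogeneous_part)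
    then show ?thesis by (auto simp: hr)
  qed
qed

lemma exact_scalar: "c \<noteq> 0 \<Longrightarrow> exact 0 (c \<odot> \<one>)"
proof -
  assume c: "c \<noteq> 0"
  have "\<theta> (const c) \<noteq> \<zero>"
  proof
    assume "\<theta> (const c) = \<zero>"
    moreover have "const (inverse c) * const c = 1"
      using c by (simp flip: const_mult)
    ultimately have "\<one> = (inverse c) \<odot> \<zero>"
      by (metis theta_one theta_smult polys_const)
    also have "\<dots> = \<zero>" by (simp add: smult_r_null[simplified])
    finally show False by simp
  qed
  then have "exact (\<sigma> * int 0) (\<theta> (const c + 0))"
    by (intro exact_leading_form) (auto simp: homogeneous_const)
  then show ?thesis by (simp add: theta_const)
qed

lemma exact_one: "exact 0 \<one>"
  using exact_scalar[of 1] by (simp add: smult_one[simplified])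

section \<open>The filtration on the field\<close>

lemma F_carrier: "x \<in> F k \<Longrightarrow> x \<in> carrier K"
  by (simp add: F_def)

lemma F_I: "x \<in> carrier K \<Longrightarrow> exact w y \<Longrightarrow> x \<otimes> y \<in> R (k + w) \<Longrightarrow> x \<in> F k"
  by (auto simp: F_def)

lemma F_E:
  assumes "x \<in> F k"
  obtains y w where "exact w y" "x \<otimes> y \<in> R (k + w)"
  using assms by (auto simp: F_def)

lemma R_F: "x \<in> R k \<Longrightarrow> x \<in> F k"
  using F_I[OF R_carrier exact_one] R_carrier by simp

lemma F_mono: "x \<in> F k \<Longrightarrow> l \<le> k \<Longrightarrow> x \<in> F l"
  using R_mono by (fastforce simp: F_def)

lemma F_add:
  assumes "x \<in> F k" "x' \<in> F k"
  shows "x \<oplus> x' \<in> F k"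
proof -
  obtain y w where y: "exact w y" "x \<otimes> y \<in> R (k + w)" by (rule F_E[OF assms(1)])
  obtain y' w' where y': "exact w' y'" "x' \<otimes> y' \<in> R (k + w')" by (rule F_E[OF assms(2)])
  note c = F_carrier[OF assms(1)] F_carrier[OF assms(2)] exact_carrier[OF y(1)] exact_carrier[OF y'(1)]
  have "(x \<otimes> y) \<otimes> y' \<in> R (k + w + w')" "(x' \<otimes> y') \<otimes> y \<in> R (k + w' + w)"
    using y y' by (auto intro: R_mult simp: exact_def)
  then have "(x \<otimes> y) \<otimes> y' \<oplus> (x' \<otimes> y') \<otimes> y \<in> R (k + (w + w'))"
    by (intro R_add) (simp_all add: ac_simps)
  also have "(x \<otimes> y) \<otimes> y' \<oplus> (x' \<otimes> y') \<otimes> y = (x \<oplus> x') \<otimes> (y \<otimes> y')"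
    using c by (simp add: l_distr m_assoc m_comm[of y y'])
  finally show ?thesis
    using c exact_mult[OF y(1) y'(1)] by (intro F_I) auto
qed

lemma F_mult:
  assumes "x \<in> F k" "x' \<in> F l"
  shows "x \<otimes> x' \<in> F (k + l)"
proof -
  obtain y w where y: "exact w y" "x \<otimes> y \<in> R (k + w)" by (rule F_E[OF assms(1)])
  obtain y' w' where y': "exact w' y'" "x' \<otimes> y' \<in> R (l + w')" by (rule F_E[OF assms(2)])
  note c = F_carrier[OF assms(1)] F_carrier[OF assms(2)] exact_carrier[OF y(1)] exact_carrier[OF y'(1)]
  have "(x \<otimes> y) \<otimes> (x' \<otimes> y') \<in> R (k + l + (w + w'))"
    using R_mult[OF y(2) y'(2)] by (simp add: ac_simps)
  also have "(x \<otimes> y) \<otimes> (x' \<otimes> y') = (x \<otimes> x') \<otimes> (y \<otimes> y')"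
    using c by (simp add: m_ac)
  finally show ?thesis
    using c exact_mult[OF y(1) y'(1)] by (intro F_I) auto
qed

text \<open>The factor \<open>y\<close> has an exact value, so it can be absorbed into the
  denominator without loss.\<close>

lemma F_divide:
  assumes "exact w y" "x \<in> carrier K" "y \<otimes> x \<in> F (k + w)"
  shows "x \<in> F k"
proof -
  obtain y' w' where y': "exact w' y'" "y \<otimes> x \<otimes> y' \<in> R (k + w + w')" by (rule F_E[OF assms(3)])
  have "y \<otimes> x \<otimes> y' = x \<otimes> (y \<otimes> y')"
    using assms(1,2) y'(1) exact_carrier by (simp add: m_ac)
  with y' show ?thesis
    using exact_mult[OF assms(1) y'(1)] assms(2) by (intro F_I) (auto simp: ac_simps)
qed

lemma F_smult:
  assumes "x \<in> F k"
  shows "c \<odot> x \<in> F k"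
proof -
  have "c \<odot> \<one> \<in> R 0"
    using exact_one by (intro R_smult) (simp add: exact_def)
  from F_mult[OF R_F[OF this] assms] show ?thesis
    using smult_assoc2[of c \<one> x] F_carrier[OF assms] by simp
qed

lemma F_uminus: "x \<in> F k \<Longrightarrow> \<ominus> x \<in> F k"
  using F_smult[of x k "- 1"] F_carrier[of x k] smult_l_minus[of 1 x]
  by (simp add: smult_one[simplified] class_ring_simps)

lemma F_zero: "\<zero> \<in> F k"
  by (intro R_F R_zero)

text \<open>The value does not depend on the denominator: clearing a second denominator
  \<open>y'\<close> as well compares the exact value \<open>u + w'\<close> of one product with its
  membership in \<open>R (k + w' + w)\<close>.\<close>

lemma F_iff:
  assumes x: "x \<in> carrier K" and y: "exact w y" and xy: "exact u (x \<otimes> y)"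
  shows "x \<in> F k \<longleftrightarrow> k \<le> u - w"
proof
  assume "k \<le> u - w"
  with xy y x show "x \<in> F k"
    by (intro F_I[of x w y]) (auto simp: exact_def intro: R_mono)
next
  assume xF: "x \<in> F k"
  show "k \<le> u - w"
  proof (rule ccontr)
    assume "\<not> k \<le> u - w"
    obtain y' w' where y': "exact w' y'" "x \<otimes> y' \<in> R (k + w')" by (rule F_E[OF xF])
    note c = x exact_carrier[OF y] exact_carrier[OF y'(1)]
    have "(x \<otimes> y') \<otimes> y \<in> R (k + w' + w)"
      using R_mult[OF y'(2), of y w] y by (simp add: exact_def)
    moreover have "(x \<otimes> y') \<otimes> y = (x \<otimes> y) \<otimes> y'"
      using c by (simp add: m_ac)
    ultimately have "(x \<otimes> y) \<otimes> y' \<in> R (u + w' + 1)"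
      using \<open>\<not> k \<le> u - w\<close> by (auto intro: R_mono)
    with exact_mult[OF xy y'(1)] show False by (simp add: exact_def)
  qed
qed

lemma exact_fraction:
  assumes "x \<in> carrier K" "x \<noteq> \<zero>"
  obtains y w u where "exact w y" "exact u (x \<otimes> y)"
proof -
  obtain a b where ab: "a \<in> polys N" "b \<in> polys N" "\<theta> b \<noteq> \<zero>" "x \<otimes> \<theta> b = \<theta> a"
    using fractions[OF assms(1)] by blast
  then have "\<theta> a \<noteq> \<zero>"
    using assms theta_closed by (metis integral_iff)
  with ab that show ?thesis
    using exact_exists[of a] exact_exists[of b] by metis
qed

section \<open>The valuation defined by the filtration\<close>

definition order :: "'b \<Rightarrow> int" where
  "order x = (THE v. \<forall>k. x \<in> F k \<longleftrightarrow> k \<le> v)"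

definition val :: "'b \<Rightarrow> int extended" where
  "val x = (if x = \<zero> then \<infinity> else Fin (order x))"

lemma order_eq:
  assumes "x \<in> carrier K" "exact w y" "exact u (x \<otimes> y)"
  shows "order x = u - w"
  unfolding order_def
proof (rule the_equality)
  show "\<forall>k. x \<in> F k \<longleftrightarrow> k \<le> u - w" using F_iff[OF assms] by blast
  fix v assume "\<forall>k. x \<in> F k \<longleftrightarrow> k \<le> v"
  then have "k \<le> v \<longleftrightarrow> k \<le> u - w" for k using F_iff[OF assms] by blast
  from this[of v] this[of "u - w"] show "v = u - w" by simp
qed

text \<open>This equivalence turns inequalities between values into closure properties of
  \<open>F\<close>; zero fits in because it belongs to every step of the filtration.\<close>

lemma Fin_le_val_iff: "x \<in> carrier K \<Longrightarrow> Fin k \<le> val x \<longleftrightarrow> x \<in> F k"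
proof (cases "x = \<zero>")
  case True
  then show ?thesis by (simp add: val_def F_zero)
next
  case False
  assume x: "x \<in> carrier K"
  obtain y w u where y: "exact w y" "exact u (x \<otimes> y)" by (rule exact_fraction[OF x False])
  show ?thesis
    using F_iff[OF x y] order_eq[OF x y] False by (simp add: val_def)
qed

lemma val_mult:
  assumes "x \<in> carrier K" "x' \<in> carrier K"
  shows "val (x \<otimes> x') = val x + val x'"
proof (cases "x = \<zero> \<or> x' = \<zero>")
  case True
  with assms show ?thesis by (auto simp: val_def)
next
  case False
  obtain y w u where y: "exact w y" "exact u (x \<otimes> y)"
    using exact_fraction[OF assms(1)] False by blast
  obtain y' w' u' where y': "exact w' y'" "exact u' (x' \<otimes> y')"
    using exact_fraction[OF assms(2)] False by blast
  note c = assms exact_carrier[OF y(1)] exact_carrier[OF y'(1)]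
  have "(x \<otimes> y) \<otimes> (x' \<otimes> y') = (x \<otimes> x') \<otimes> (y \<otimes> y')"
    using c by (simp add: m_ac)
  then have "exact (u + u') ((x \<otimes> x') \<otimes> (y \<otimes> y'))"
    using exact_mult[OF y(2) y'(2)] by simp
  then have "order (x \<otimes> x') = (u + u') - (w + w')"
    using c by (intro order_eq[OF _ exact_mult[OF y(1) y'(1)]]) auto
  moreover have "x \<otimes> x' \<noteq> \<zero>" using False assms by (simp add: integral_iff)
  ultimately show ?thesis
    using False order_eq[OF assms(1) y] order_eq[OF assms(2) y'] by (simp add: val_def)
qed

lemma val_add:
  assumes "x \<in> carrier K" "y \<in> carrier K"
  shows "min (val x) (val y) \<le> val (x \<oplus> y)"
proof (cases "min (val x) (val y)")
  case (Fin k)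
  then have "Fin k \<le> val x" "Fin k \<le> val y" by (metis min.cobounded1 min.cobounded2)+
  with assms have "x \<oplus> y \<in> F k" by (intro F_add) (auto simp: Fin_le_val_iff)
  with Fin assms show ?thesis by (simp add: Fin_le_val_iff)
next
  case Pinf
  then show ?thesis using assms by (auto simp: val_def split: if_splits)
qed simp

text \<open>The value of the sum cannot jump, for otherwise \<open>x\<close>, recovered as the sum
  minus \<open>y\<close>, would itself have a larger value.\<close>

lemma val_add_less:
  assumes "x \<in> carrier K" "y \<in> carrier K" "val x < val y"
  shows "val (x \<oplus> y) = val x"
proof -
  obtain a where a: "val x = Fin a" "x \<noteq> \<zero>"
    using assms(3) by (auto simp: val_def split: if_splits)
  have "\<not> Fin (a + 1) \<le> val (x \<oplus> y)"
  proof
    assume "Fin (a + 1) \<le> val (x \<oplus> y)"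
    moreover have "Fin (a + 1) \<le> val y"
      using assms(3) a by (cases "val y") auto
    ultimately have "(x \<oplus> y) \<oplus> (\<ominus> y) \<in> F (a + 1)"
      using assms by (intro F_add[OF _ F_uminus]) (simp_all add: Fin_le_val_iff)
    also have "(x \<oplus> y) \<oplus> (\<ominus> y) = x"
      using assms by (simp add: M.a_assoc M.r_neg)
    finally show False using assms(1) a(1) by (simp flip: Fin_le_val_iff)
  qed
  moreover have "Fin a \<le> val (x \<oplus> y)"
    using val_add[OF assms(1,2)] assms(3) a by (simp add: min_def split: if_splits)
  ultimately show ?thesis
    unfolding a by (cases "val (x \<oplus> y)") auto
qed

lemma val_add_eq:
  assumes "x \<in> carrier K" "y \<in> carrier K" "val x \<noteq> val y"
  shows "val (x \<oplus> y) = min (val x) (val y)"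
  using val_add_less[OF assms(1,2)] val_add_less[OF assms(2,1)] assms M.a_comm[OF assms(1,2)]
  by (cases "val x < val y") (auto simp: min_def)

end

section \<open>Derivations and brackets\<close>

context nambu_poisson_algebra
begin

lemma bracket_update_closed:
  "length us = n \<Longrightarrow> set us \<subseteq> carrier P \<Longrightarrow> x \<in> carrier P \<Longrightarrow> \<lbrace>us[i := x]\<rbrace> \<in> carrier P"
  by (rule bracket_closed) (use set_update_subset_insert[of us i x] in auto)

lemma bracket_update_zero:
  assumes "length us = n" "set us \<subseteq> carrier P" "i < n"
  shows "\<lbrace>us[i := \<zero>]\<rbrace> = \<zero>"
  using bracket_smult[OF assms, of \<zero> 0] bracket_update_closed[OF assms(1,2), of \<zero> i]
  by (simp add: smult_l_null[simplified])

text \<open>Polarisation: with \<open>x \<oplus> y\<close> in both slots the bracket vanishes, and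
  so do the two diagonal terms of its expansion.\<close>

lemma bracket_swap:
  assumes us: "length us = n" "set us \<subseteq> carrier P" and ij: "i < n" "j < n" "i \<noteq> j"
    and xy: "x \<in> carrier P" "y \<in> carrier P"
  shows "\<lbrace>us[i := x, j := y]\<rbrace> = \<ominus> \<lbrace>us[i := y, j := x]\<rbrace>"
proof -
  have alt: "\<lbrace>us[i := z, j := z]\<rbrace> = \<zero>" if "z \<in> carrier P" for z
  proof (rule bracket_alternating[of _ "min i j" "max i j"])
    show "set (us[i := z, j := z]) \<subseteq> carrier P"
      using us that set_update_subset_insert[of us i z] set_update_subset_insert[of "us[i := z]" j z]
      by auto
  qed (use us ij in \<open>auto simp: min_def max_def nth_list_update\<close>)
  have sub: "set (us[i := z]) \<subseteq> carrier P" if "z \<in> carrier P" for z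
    using us that set_update_subset_insert[of us i z] by auto
  have expand_j: "\<lbrace>us[i := z, j := x \<oplus> y]\<rbrace> = \<lbrace>us[i := z, j := x]\<rbrace> \<oplus> \<lbrace>us[i := z, j := y]\<rbrace>"
    if "z \<in> carrier P" for z
    using us ij xy sub[OF that] by (intro bracket_add) auto
  have expand_i: "\<lbrace>us[i := x \<oplus> y, j := z]\<rbrace> = \<lbrace>us[i := x, j := z]\<rbrace> \<oplus> \<lbrace>us[i := y, j := z]\<rbrace>"
    if "z \<in> carrier P" for z
  proof -
    have "set (us[j := z]) \<subseteq> carrier P"
      using us that set_update_subset_insert[of us j z] by auto
    then have "\<lbrace>us[j := z, i := x \<oplus> y]\<rbrace> = \<lbrace>us[j := z, i := x]\<rbrace> \<oplus> \<lbrace>us[j := z, i := y]\<rbrace>"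
      using us ij xy by (intro bracket_add) auto
    then show ?thesis by (simp only: list_update_swap[OF ij(3)[symmetric]])
  qed
  have closed: "\<lbrace>us[i := z, j := z']\<rbrace> \<in> carrier P" if "z \<in> carrier P" "z' \<in> carrier P" for z z'
    using us that sub by (intro bracket_update_closed) auto
  have "\<zero> = \<lbrace>us[i := x \<oplus> y, j := x \<oplus> y]\<rbrace>"
    using alt xy by simp
  also have "\<dots> = \<lbrace>us[i := x, j := x \<oplus> y]\<rbrace> \<oplus> \<lbrace>us[i := y, j := x \<oplus> y]\<rbrace>"
    using xy by (intro expand_i) simp
  also have "\<dots> = \<lbrace>us[i := x, j := y]\<rbrace> \<oplus> \<lbrace>us[i := y, j := x]\<rbrace>"
    using xy closed by (simp add: expand_j alt)
  finally show ?thesis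
    using closed xy M.minus_equality by metis
qed

end

context graded_point
begin

text \<open>The Leibniz rule carries a shift by \<open>c\<close> from the generators, whose weight
  is \<open>\<sigma>\<close>, to all monomials, and linearity carries it to \<open>R\<close>. For a
  fraction, \<open>\<delta> (x \<otimes> y)\<close> minus \<open>x \<otimes> \<delta> y\<close>
  equals \<open>y \<otimes> \<delta> x\<close>, and dividing by \<open>y\<close> is harmless because
  its value is exact.\<close>

lemma derivation_F:
  assumes closed: "\<And>x. x \<in> carrier K \<Longrightarrow> \<delta> x \<in> carrier K"
    and add: "\<And>x y. x \<in> carrier K \<Longrightarrow> y \<in> carrier K \<Longrightarrow> \<delta> (x \<oplus> y) = \<delta> x \<oplus> \<delta> y"
    and smult: "\<And>c x. x \<in> carrier K \<Longrightarrow> \<delta> (c \<odot> x) = c \<odot> \<delta> x"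
    and leibniz: "\<And>x y. x \<in> carrier K \<Longrightarrow> y \<in> carrier K \<Longrightarrow>
      \<delta> (x \<otimes> y) = x \<otimes> \<delta> y \<oplus> y \<otimes> \<delta> x"
    and vars: "\<And>j. j < N \<Longrightarrow> \<delta> (\<theta> (var j)) \<in> F (c + \<sigma>)"
    and x: "x \<in> F k"
  shows "\<delta> x \<in> F (k + c)"
proof -
  have zero: "\<delta> \<zero> = \<zero>"
    using smult[of \<zero> 0] closed[of \<zero>] by (simp add: smult_l_null[simplified])
  have "\<delta> \<one> = \<delta> \<one> \<oplus> \<delta> \<one>"
    using leibniz[of \<one> \<one>] closed[of \<one>] by simp
  then have one: "\<delta> \<one> = \<zero>"
    using closed[of \<one>] by (metis M.add.r_cancel_one one_closed)
  have mono: "Poly_Mapping.keys m \<subseteq> {..<N} \<Longrightarrow>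
      \<delta> (\<theta> (Poly_Mapping.single m 1)) \<in> F (\<sigma> * int (mdeg m) + c)" for m
  proof (induction m rule: mdeg_induct)
    case zero
    then show ?case by (simp add: theta_one one F_zero)
  next
    case (var i m)
    note * = theta_var_monomial[OF var.prems]
    let ?x = "\<theta> (var i)" and ?y = "\<theta> (Poly_Mapping.single m 1)"
    have c: "?x \<in> carrier K" "?y \<in> carrier K"
      using * polys_var polys_single by blast+
    have "?x \<in> F (\<sigma> * int 1)"
      by (rule R_F[OF homogeneous_R[OF polys_var[OF *(1)] homogeneous_var]])
    moreover have "?y \<in> F (\<sigma> * int (mdeg m))"
      by (rule R_F[OF homogeneous_R[OF polys_single[OF *(2)]]]) (simp add: homogeneous_iff)
    ultimately have "?x \<otimes> \<delta> ?y \<in> F (\<sigma> * int 1 + (\<sigma> * int (mdeg m) + c))"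
        "?y \<otimes> \<delta> ?x \<in> F (\<sigma> * int (mdeg m) + (c + \<sigma>))"
      using F_mult var.IH[OF *(2)] vars[OF *(1)] by blast+
    then have "?x \<otimes> \<delta> ?y \<oplus> ?y \<otimes> \<delta> ?x \<in> F (\<sigma> * int (1 + mdeg m) + c)"
      by (intro F_add) (simp_all add: algebra_simps)
    then show ?case
      using c by (simp only: *(3) leibniz mdeg_add mdeg_single)
  qed
  have R: "\<delta> z \<in> F (l + c)" if "z \<in> R l" for z l
  proof -
    obtain p where p: "wge l p" "z = \<theta> p" using \<open>z \<in> R l\<close> by (rule R_E)
    show ?thesis
      unfolding p(2)
    proof (rule theta_monomial_induct[where P = "\<lambda>z. \<delta> z \<in> F (l + c)"])
      fix m assume m: "m \<in> Poly_Mapping.keys p" "Poly_Mapping.keys m \<subseteq> {..<N}"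
      then have "l \<le> \<sigma> * int (mdeg m)" using p(1) by (auto simp: wge_def)
      then show "\<delta> (\<theta> (Poly_Mapping.single m 1)) \<in> F (l + c)"
        using F_mono[OF mono[OF m(2)]] by simp
    qed (use p(1) in \<open>auto simp: wge_polys zero F_zero add smult intro: F_add F_smult\<close>)
  qed
  obtain y w where y: "exact w y" "x \<otimes> y \<in> R (k + w)" by (rule F_E[OF x])
  note c = F_carrier[OF x] exact_carrier[OF y(1)]
  have yR: "y \<in> R w" using y(1) by (simp add: exact_def)
  have "x \<otimes> \<delta> y \<in> F (k + (w + c))"
    by (rule F_mult[OF x R[OF yR]])
  then have "\<delta> (x \<otimes> y) \<oplus> \<ominus> (x \<otimes> \<delta> y) \<in> F (k + c + w)"
    using R[OF y(2)] by (intro F_add F_uminus) (simp_all add: ac_simps)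
  also have "\<delta> (x \<otimes> y) \<oplus> \<ominus> (x \<otimes> \<delta> y) = y \<otimes> \<delta> x"
  proof -
    have "\<delta> (x \<otimes> y) = x \<otimes> \<delta> y \<oplus> y \<otimes> \<delta> x" using c by (rule leibniz)
    then show ?thesis
      using c closed by (simp add: M.a_comm[of "x \<otimes> \<delta> y"] M.a_assoc M.r_neg)
  qed
  finally show ?thesis
    by (rule F_divide[OF y(1) closed[OF c(1)]])
qed

text \<open>With all other slots fixed the bracket is a derivation in the remaining one, so the
  slots can be freed from generators one at a time.\<close>

lemma bracket_F:
  assumes gens: "\<And>is. length is = n \<Longrightarrow> set is \<subseteq> {..<N} \<Longrightarrow>
      \<lbrace>map (\<lambda>i. \<theta> (var i)) is\<rbrace> \<in> R (1 + int n * \<sigma>)"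
    and bs: "length bs = n" "set bs \<subseteq> carrier K" and s: "\<And>i. i < n \<Longrightarrow> bs ! i \<in> F (s i)"
  shows "\<lbrace>bs\<rbrace> \<in> F (1 + (\<Sum>i<n. s i))"
proof -
  \<comment> \<open>The first \<open>k\<close> slots are arbitrary; the others still hold generators
    and contribute \<open>\<sigma>\<close> each.\<close>
  have "\<lbrace>bs\<rbrace> \<in> F (1 + (\<Sum>i<n. s i))"
    if "k \<le> n" "length bs = n" "set bs \<subseteq> carrier K" "\<And>i. i < k \<Longrightarrow> bs ! i \<in> F (s i)"
      "\<And>i. k \<le> i \<Longrightarrow> i < n \<Longrightarrow> s i = \<sigma> \<and> (\<exists>j<N. bs ! i = \<theta> (var j))"
    for k bs s
    using that
  proof (induction k arbitrary: bs s)
    case 0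
    then have "\<forall>i<n. \<exists>j<N. bs ! i = \<theta> (var j)" by blast
    then obtain f where f: "\<And>i. i < n \<Longrightarrow> f i < N \<and> bs ! i = \<theta> (var (f i))" by metis
    then have "bs = map (\<lambda>i. \<theta> (var i)) (map f [0..<n])"
      using 0 by (intro nth_equalityI) auto
    moreover have "(\<Sum>i<n. s i) = int n * \<sigma>"
      using 0(5) by simp
    moreover have "set (map f [0..<n]) \<subseteq> {..<N}"
      using f by auto
    ultimately show ?case
      using gens[of "map f [0..<n]"] by (auto intro!: R_F)
  next
    case (Suc k)
    \<comment> \<open>The shift for \<open>derivation_F\<close> is the desired bound without the
      share of slot \<open>k\<close>. The induction hypothesis supplies the bound with a generator,
      of share \<open>\<sigma>\<close>, in that slot.\<close>
    let ?c = "1 + (\<Sum>i<n. s i) - s k"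
    have k: "k < n" using Suc.prems by simp
    have "\<lbrace>bs[k := bs ! k]\<rbrace> \<in> F (s k + ?c)"
    proof (rule derivation_F[where \<delta> = "\<lambda>x. \<lbrace>bs[k := x]\<rbrace>"])
      fix j assume j: "j < N"
      let ?s = "s(k := \<sigma>)"
      have "(\<Sum>i<n. ?s i) = (\<Sum>i<n. s i) - s k + \<sigma>"
        using k by (simp add: sum.remove[of "{..<n}" k])
      then have "1 + (\<Sum>i<n. ?s i) = ?c + \<sigma>" by simp
      moreover have "\<lbrace>bs[k := \<theta> (var j)]\<rbrace> \<in> F (1 + (\<Sum>i<n. ?s i))"
      proof (rule Suc.IH)
        show "set (bs[k := \<theta> (var j)]) \<subseteq> carrier K"
          using Suc.prems(3) set_update_subset_insert[of bs k] theta_closed[OF polys_var[OF j]]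
          by fastforce
      qed (use Suc.prems k j in \<open>auto simp: nth_list_update\<close>)
      ultimately show "\<lbrace>bs[k := \<theta> (var j)]\<rbrace> \<in> F (?c + \<sigma>)" by (simp only:)
    qed (use Suc.prems k bracket_update_closed bracket_add bracket_smult leibniz in auto)
    then show ?case by simp
  qed
  from this[of n bs s] assms show ?thesis by simp
qed

lemma val_is_valuation:
  assumes gens: "\<And>is. length is = n \<Longrightarrow> set is \<subseteq> {..<N} \<Longrightarrow>
      \<lbrace>map (\<lambda>i. \<theta> (var i)) is\<rbrace> \<in> R (1 + int n * \<sigma>)"
  shows "is_valuation n (- 1) K val"
  unfolding is_valuation_def
proof (intro conjI ballI allI impI)
  fix c :: 'k assume "c \<noteq> 0"
  then have "exact 0 (c \<odot> \<one>)" by (rule exact_scalar)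
  then have "order (c \<odot> \<one>) = 0 - 0"
    using exact_carrier by (intro order_eq[OF _ exact_one]) auto
  with \<open>exact 0 (c \<odot> \<one>)\<close> show "val (c \<odot> \<one>) = 0"
    using exact_nonzero by (simp add: val_def zero_extended_def)
next
  fix bs assume bs: "length bs = n" "set bs \<subseteq> carrier K"
  show "Fin (- (- 1)) + (\<Sum>b\<leftarrow>bs. val b) \<le> val (\<lbrace>bs\<rbrace>)"
  \<comment> \<open>\<open>order\<close> is meaningful only away from zero; a zero argument makes
    the bracket zero, of value \<infinity>.\<close>
  proof (cases "\<zero> \<in> set bs")
    case True
    then obtain i where i: "i < n" "bs ! i = \<zero>" using bs by (auto simp: in_set_conv_nth)
    then have "\<lbrace>bs[i := \<zero>]\<rbrace> = \<zero>" using bs by (intro bracket_update_zero)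
    then have "\<lbrace>bs\<rbrace> = \<zero>" using i by (metis list_update_id)
    then show ?thesis by (simp add: val_def)
  next
    case False
    have val: "val b = Fin (order b)" if "b \<in> set bs" for b
      using that False by (auto simp: val_def)
    have "(\<Sum>b\<leftarrow>bs. val b) = (\<Sum>b\<leftarrow>bs. Fin (order b))"
      using val by (intro arg_cong[where f = sum_list] map_cong) auto
    also have "\<dots> = Fin (\<Sum>b\<leftarrow>bs. order b)"
      by (induction bs) (simp_all add: zero_extended_def)
    also have "(\<Sum>b\<leftarrow>bs. order b) = (\<Sum>i<n. order (bs ! i))"
      using bs by (simp add: sum_list_sum_nth atLeast0LessThan)
    finally have sum: "(\<Sum>b\<leftarrow>bs. val b) = Fin (\<Sum>i<n. order (bs ! i))" .
    have "\<lbrace>bs\<rbrace> \<in> F (1 + (\<Sum>i<n. order (bs ! i)))"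
    proof (rule bracket_F[OF gens bs])
      fix i assume "i < n"
      then have "bs ! i \<in> set bs" using bs by simp
      then show "bs ! i \<in> F (order (bs ! i))"
        using bs(2) val[of "bs ! i"] by (metis Fin_le_val_iff order_refl subsetD)
    qed
    then show ?thesis
      using bracket_closed[OF bs] by (simp add: sum Fin_le_val_iff)
  qed
qed (auto simp: val_def val_mult[unfolded val_def] val_add[unfolded val_def]
      val_add_eq[unfolded val_def])

end

section \<open>Morphisms\<close>

lemma alg_hom_comp: "f \<in> alg_hom A B \<Longrightarrow> g \<in> alg_hom B C \<Longrightarrow> g \<circ> f \<in> alg_hom A C"
  by (auto simp: alg_hom_def Ring.ring_hom_def Pi_iff)

lemma nambu_hom_comp:
  assumes "f \<in> nambu_hom n A B" "g \<in> nambu_hom n B C"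
  shows "g \<circ> f \<in> nambu_hom n A C"
proof -
  have "set (map f us) \<subseteq> carrier B" if "set us \<subseteq> carrier A" for us
    using that assms(1) by (auto simp: nambu_hom_def alg_hom_def Ring.ring_hom_def)
  then show ?thesis
    using assms alg_hom_comp[of f A B g C] by (auto simp: nambu_hom_def simp flip: map_map)
qed

text \<open>The fraction property with the inverse cleared, as \<open>graded_point\<close> asks for
  it.\<close>

lemma (in nambu_poisson_field) fraction_embedding_fractions:
  assumes emb: "fraction_embedding A P \<iota>"
    and zero: "\<iota> \<zero>\<^bsub>A\<^esub> = \<zero>" "\<zero>\<^bsub>A\<^esub> \<in> carrier A" and x: "x \<in> carrier P"
  shows "\<exists>a\<in>carrier A. \<exists>b\<in>carrier A. \<iota> b \<noteq> \<zero> \<and> x \<otimes> \<iota> b = \<iota> a"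
proof -
  obtain a b where ab: "a \<in> carrier A" "b \<in> carrier A" "b \<noteq> \<zero>\<^bsub>A\<^esub>" "x = \<iota> a \<otimes> inv (\<iota> b)"
    using emb x unfolding fraction_embedding_def by blast
  have closed: "\<iota> a \<in> carrier P" "\<iota> b \<in> carrier P"
    using emb ab by (auto simp: fraction_embedding_def alg_hom_def Ring.ring_hom_def)
  have nz: "\<iota> b \<noteq> \<zero>"
    using emb ab zero by (auto simp: fraction_embedding_def inj_on_def)
  then have "\<iota> b \<in> Units P"
    using closed by (simp add: field_Units)
  then have "x \<otimes> \<iota> b = \<iota> a"
    using closed by (simp add: ab(4) m_assoc)
  with ab nz show ?thesis by blast
qed

context potential_quotient
begin

text \<open>A morphism out of the quotient becomes a point at which brackets are images of Jacobian
  determinants; cosets can be forgotten from here on.\<close>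

lemma nambu_hom_proj:
  assumes "\<psi> \<in> nambu_hom n P L"
  shows "\<psi> \<circ> Q.proj \<in> alg_hom (poly_alg (n + 1)) L"
    and "length fs = n \<Longrightarrow> set fs \<subseteq> polys (n + 1) \<Longrightarrow>
      \<lbrace>map (\<psi> \<circ> Q.proj) fs\<rbrace>\<^bsub>L\<^esub> = (\<psi> \<circ> Q.proj) (jac n \<Omega> fs)"
proof -
  show "\<psi> \<circ> Q.proj \<in> alg_hom (poly_alg (n + 1)) L"
    using assms by (intro alg_hom_comp[OF proj_hom]) (simp add: nambu_hom_def)
  assume fs: "length fs = n" "set fs \<subseteq> polys (n + 1)"
  then have "set (map Q.proj fs) \<subseteq> carrier P"
    by (auto simp: P_fields(1))
  then have "\<psi> (\<lbrace>map Q.proj fs\<rbrace>\<^bsub>P\<^esub>) = \<lbrace>map \<psi> (map Q.proj fs)\<rbrace>\<^bsub>L\<^esub>"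
    using assms fs(1) by (simp add: nambu_hom_def)
  then show "\<lbrace>map (\<psi> \<circ> Q.proj) fs\<rbrace>\<^bsub>L\<^esub> = (\<psi> \<circ> Q.proj) (jac n \<Omega> fs)"
    using bracket_P[OF fs] by simp
qed

end

lemma no_hom_of_valuation:
  fixes \<Omega> :: "'k::field mvpoly"
  assumes pot: "is_potential (n + 1) d \<Omega>" and d: "d \<ge> n + 1"
    and N: "is_nambu_fraction_field n (P_alg n \<Omega> 1) N"
    and K: "nambu_poisson_field n K" and \<nu>: "is_valuation n (- 1) K \<nu>"
  shows "nambu_hom n N K = {}"
proof (rule ccontr)
  assume "nambu_hom n N K \<noteq> {}"
  then obtain \<phi> where \<phi>: "\<phi> \<in> nambu_hom n N K" by blast
  obtain \<iota> where "\<iota> \<in> nambu_hom n (P_alg n \<Omega> 1) N"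
    using N by (auto simp: is_nambu_fraction_field_def)
  with \<phi> have \<psi>: "\<phi> \<circ> \<iota> \<in> nambu_hom n (P_alg n \<Omega> 1) K"
    by (intro nambu_hom_comp)
  have \<Omega>: "\<Omega> \<in> polys (n + 1)"
    using pot by (simp add: is_potential_def)
  interpret PQ: potential_quotient n \<Omega> 1
    by (rule potential_quotient.intro[OF \<Omega>])
  define \<theta> where "\<theta> = (\<phi> \<circ> \<iota>) \<circ> PQ.Q.proj"
  interpret nambu_poisson_field n K by (rule K)
  interpret valued_point n K "- 1" \<nu> "n + 1" \<theta>
    by unfold_locales (use \<nu> PQ.nambu_hom_proj(1)[OF \<psi>] in \<open>simp_all add: \<theta>_def\<close>)
  \<comment> \<open>The ideal is generated by \<open>\<Omega> - const 1\<close>, so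
    \<open>\<Omega>\<close> and 1 have the same image in \<open>K\<close>.\<close>
  have "PQ.Q.proj (\<Omega> - const 1) = PQ.Q.proj 0"
    using PQ.proj_eq_zero_iff[of "\<Omega> - const 1"] \<Omega> PQ.P_fields(4)
    by (metis mult_1 polys_const polys_diff polys_one)
  then have "\<theta> (\<Omega> - 1) = \<zero>\<^bsub>K\<^esub>"
    using theta_zero by (simp add: \<theta>_def)
  then have "\<theta> (1 + (\<Omega> - 1)) = \<one>\<^bsub>K\<^esub>"
    using \<Omega> polys_one by (subst theta_add) (auto simp: theta_one)
  then have one: "\<theta> \<Omega> = \<one>\<^bsub>K\<^esub>" by simp
  show False
  proof (rule potential_point_contradiction[OF refl refl pot d one])
    fix i assume i: "i < n + 1"
    let ?fs = "map (\<lambda>r. var (if r < i then r else Suc r)) [0..<n] :: 'k mvpoly list"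
    have "set ?fs \<subseteq> polys (n + 1)"
      by auto
    then have "\<lbrace>map \<theta> ?fs\<rbrace>\<^bsub>K\<^esub> = \<theta> (jac n \<Omega> ?fs)"
      unfolding \<theta>_def by (intro PQ.nambu_hom_proj(2)[OF \<psi>]) simp_all
    then show "\<lbrace>map (\<lambda>r. \<theta> (var (if r < i then r else Suc r))) [0..<n]\<rbrace>\<^bsub>K\<^esub>
        = \<theta> ((- 1) ^ (n + i) * partial_deriv i \<Omega>)"
      by (simp add: jac_omit_var[OF i] comp_def)
  qed
qed

text \<open>A repeated generator gives 0, and distinct ones can be sorted at the cost of a sign. The
  bracket is thus 0 or \<plusminus>1, which suffices because \<open>1 - n \<le> 0\<close>.\<close>

lemma (in graded_point) weyl_bracket_vars:
  assumes N: "N = n" and \<sigma>: "\<sigma> = - 1" and n: "n \<ge> 1"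
    and br: "\<lbrace>map (\<lambda>i. \<theta> (var i)) [0..<n]\<rbrace> = \<one>"
    and "is": "length is = n" "set is \<subseteq> {..<N}"
  shows "\<lbrace>map (\<lambda>i. \<theta> (var i)) is\<rbrace> \<in> R (1 + int n * \<sigma>)"
proof (cases "distinct is")
  case False
  have c: "set (map (\<lambda>i. \<theta> (var i)) is) \<subseteq> carrier K"
    using "is" theta_closed polys_var by auto
  from False obtain i j where ij: "i < j" "j < n" "is ! i = is ! j"
    using "is" unfolding distinct_conv_nth by (metis linorder_neqE_nat)
  then have "\<lbrace>map (\<lambda>i. \<theta> (var i)) is\<rbrace> = \<zero>"
    using "is"(1) by (intro bracket_alternating[OF _ c ij(1,2)]) auto
  then show ?thesis by (simp add: R_zero)
next
  case True
  \<comment> \<open>Selection sort: the first \<open>k\<close> slots are correct, and one swap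
    brings the entry \<open>k\<close> into slot \<open>k\<close>.\<close>
  have "\<lbrace>map (\<lambda>i. \<theta> (var i)) is\<rbrace> \<in> R (1 + int n * \<sigma>)"
    if "length is = n" "set is \<subseteq> {..<N}" "distinct is" "\<And>i. i < k \<Longrightarrow> i < n \<Longrightarrow> is ! i = i" for k "is"
    using that
  proof (induction "n - k" arbitrary: k "is")
    case 0
    then have "is = [0..<n]"
      by (intro nth_equalityI) auto
    moreover have "\<one> \<in> R 0"
      using exact_one by (simp add: exact_def)
    then have "\<one> \<in> R (1 + int n * \<sigma>)"
      by (rule R_mono) (use n \<sigma> in simp)
    ultimately show ?case by (simp add: br)
  next
    case (Suc l)
    then have k: "k < n" by simp
    have "card (set is) = n"
      using Suc.prems by (simp add: distinct_card)
    then have "set is = {..<n}"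
      using Suc.prems(2) N by (intro card_subset_eq) auto
    then obtain j where j: "j < n" "is ! j = k"
      using k Suc.prems(1) by (metis in_set_conv_nth lessThan_iff)
    have "\<not> j < k"
      using Suc.prems(4)[of j] j by auto
    let ?js = "is[k := is ! j, j := is ! k]"
    have IH: "\<lbrace>map (\<lambda>i. \<theta> (var i)) ?js\<rbrace> \<in> R (1 + int n * \<sigma>)"
    proof (rule Suc.hyps(1)[of "Suc k"])
      show "l = n - Suc k" using Suc.hyps(2) by simp
      show "distinct ?js" "set ?js \<subseteq> {..<N}"
        using Suc.prems(1-3) k j(1) by simp_all
      fix i assume "i < Suc k" "i < n"
      then show "?js ! i = i"
        using Suc.prems(1,4) k j \<open>\<not> j < k\<close> by (auto simp: nth_list_update less_Suc_eq)
    qed (use Suc.prems in simp)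
    show ?case
    proof (cases "j = k")
      case True
      then show ?thesis using IH by simp
    next
      case False
      let ?us = "map (\<lambda>i. \<theta> (var i)) is"
      have us: "length ?us = n" "set ?us \<subseteq> carrier K"
        using Suc.prems theta_closed polys_var by auto
      have "\<lbrace>?us[k := ?us ! k, j := ?us ! j]\<rbrace> = \<ominus> \<lbrace>?us[k := ?us ! j, j := ?us ! k]\<rbrace>"
        using us k j False by (intro bracket_swap) (auto intro!: subsetD[OF us(2)] nth_mem simp del: nth_map)
      moreover have "?us[k := ?us ! k, j := ?us ! j] = ?us" by (simp only: list_update_id)
      moreover have "?us[k := ?us ! j, j := ?us ! k] = map (\<lambda>i. \<theta> (var i)) ?js"
        using Suc.prems(1) k j by (simp add: map_update)
      ultimately show ?thesis using R_uminus[OF IH] by simp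
    qed
  qed
  from this[of "is" 0] "is" True show ?thesis by simp
qed

lemma weyl_field_valuation:
  assumes n: "n \<ge> 1" and weyl: "is_weyl_field n K"
  shows "\<exists>\<nu>. is_valuation n (- 1) K \<nu>"
proof -
  interpret nambu_poisson_field n K
    using weyl by (simp add: is_weyl_field_def)
  obtain \<iota> where emb: "fraction_embedding (poly_alg n) K \<iota>"
    and br: "\<lbrace>map (\<lambda>i. \<iota> (var i)) [0..<n]\<rbrace>\<^bsub>K\<^esub> = \<one>\<^bsub>K\<^esub>"
    using weyl by (auto simp: is_weyl_field_def)
  interpret polynomial_point n K n \<iota>
    by unfold_locales (use emb in \<open>simp add: fraction_embedding_def\<close>)
  \<comment> \<open>The kernel is zero since \<open>\<iota>\<close> is injective, so
    \<open>graded_kernel\<close> only says that a form cancels against nothing of other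
    degrees.\<close>
  interpret graded_point n K n \<iota> "- 1"
  proof unfold_locales
    fix x assume "x \<in> carrier K"
    then show "\<exists>a\<in>polys n. \<exists>b\<in>polys n. \<iota> b \<noteq> \<zero>\<^bsub>K\<^esub> \<and> x \<otimes>\<^bsub>K\<^esub> \<iota> b = \<iota> a"
      using fraction_embedding_fractions[OF emb] theta_zero by (simp add: poly_alg_def)
  next
    fix h r e
    assume hr: "h \<in> polys n" "r \<in> polys n" "homogeneous e h" "avoids_degree e r" "\<iota> (h + r) = \<zero>\<^bsub>K\<^esub>"
    have "inj_on \<iota> (polys n)"
      using emb by (simp add: fraction_embedding_def poly_alg_def)
    then have "h + r = 0"
      by (rule inj_onD) (use hr(5) theta_zero polys_add[OF hr(1,2)] in simp_all)
    then have "h = 0"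
      by (rule homogeneous_add_avoids_degree_eq_zero[OF _ hr(3,4)])
    then show "\<iota> h = \<zero>\<^bsub>K\<^esub>" by (simp add: theta_zero)
  qed simp
  have "is_valuation n (- 1) K val"
    by (rule val_is_valuation) (rule weyl_bracket_vars[OF refl refl n br])
  then show ?thesis by blast
qed

lemma potential_field_valuation:
  fixes \<Omega> :: "'k::field mvpoly"
  assumes pot: "is_potential (n + 1) d \<Omega>" and d: "d \<ge> n + 2"
    and K: "is_nambu_fraction_field n (P_alg n \<Omega> 0) K"
  shows "\<exists>\<nu>. is_valuation n (- 1) K \<nu>"
proof -
  interpret nambu_poisson_field n K
    using K by (simp add: is_nambu_fraction_field_def)
  obtain \<iota> where \<iota>: "\<iota> \<in> nambu_hom n (P_alg n \<Omega> 0) K"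
    and emb: "fraction_embedding (P_alg n \<Omega> 0) K \<iota>"
    using K by (auto simp: is_nambu_fraction_field_def)
  have \<Omega>: "\<Omega> \<in> polys (n + 1)" "homogeneous d \<Omega>"
    using pot by (simp_all add: is_potential_def)
  interpret PQ: potential_quotient n \<Omega> 0
    by (rule potential_quotient.intro[OF \<Omega>(1)])
  define \<theta> where "\<theta> = \<iota> \<circ> PQ.Q.proj"
  interpret polynomial_point n K "n + 1" \<theta>
    by unfold_locales (use PQ.nambu_hom_proj(1)[OF \<iota>] in \<open>simp add: \<theta>_def\<close>)
  have zero: "\<iota> \<zero>\<^bsub>PQ.P\<^esub> = \<zero>\<^bsub>K\<^esub>" "\<zero>\<^bsub>PQ.P\<^esub> \<in> carrier PQ.P"
    using theta_zero by (simp_all add: \<theta>_def PQ.P_fields)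
  have kernel: "\<theta> p = \<zero>\<^bsub>K\<^esub> \<longleftrightarrow> (\<exists>g\<in>polys (n + 1). p = g * \<Omega>)" if p: "p \<in> polys (n + 1)" for p
  proof -
    have "PQ.Q.proj p \<in> carrier PQ.P" using p by (simp add: PQ.P_fields(1))
    then have "\<theta> p = \<zero>\<^bsub>K\<^esub> \<longleftrightarrow> PQ.Q.proj p = \<zero>\<^bsub>PQ.P\<^esub>"
      using emb zero unfolding \<theta>_def comp_def fraction_embedding_def inj_on_def by metis
    then show ?thesis using PQ.proj_eq_zero_iff[OF p] by simp
  qed
  \<comment> \<open>The kernel consists of the multiples of \<open>\<Omega>\<close>; at level 0 the
    generator is a form, so the ideal is homogeneous.\<close>
  interpret graded_point n K "n + 1" \<theta> 1
  proof unfold_locales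
    fix x assume "x \<in> carrier K"
    then obtain a b where "a \<in> carrier PQ.P" "b \<in> carrier PQ.P" "\<iota> b \<noteq> \<zero>\<^bsub>K\<^esub>" "x \<otimes>\<^bsub>K\<^esub> \<iota> b = \<iota> a"
      using fraction_embedding_fractions[OF emb zero] by blast
    then show "\<exists>a\<in>polys (n + 1). \<exists>b\<in>polys (n + 1). \<theta> b \<noteq> \<zero>\<^bsub>K\<^esub> \<and> x \<otimes>\<^bsub>K\<^esub> \<theta> b = \<theta> a"
      by (auto simp: \<theta>_def PQ.P_fields(1))
  next
    fix h r e
    assume hr: "h \<in> polys (n + 1)" "r \<in> polys (n + 1)" "homogeneous e h" "avoids_degree e r"
      "\<theta> (h + r) = \<zero>\<^bsub>K\<^esub>"
    then obtain g where g: "g \<in> polys (n + 1)" "h + r = g * \<Omega>"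
      using kernel polys_add by metis
    \<comment> \<open>The component of \<open>g\<close> of degree \<open>e - d\<close>, with the
      condition written additively so that it is empty for \<open>e < d\<close>.\<close>
    define g1 where "g1 = part (\<lambda>m. mdeg m + d = e) g"
    define g2 where "g2 = part (\<lambda>m. mdeg m + d \<noteq> e) g"
    have "g = g1 + g2" by (simp add: g1_def g2_def part_split)
    then have "(h - g1 * \<Omega>) + (r - g2 * \<Omega>) = 0"
      using g(2) by (simp add: algebra_simps)
    moreover have "homogeneous e (g1 * \<Omega>)"
      using keys_mult[of g1 \<Omega>] \<Omega>(2) by (force simp: homogeneous_iff g1_def keys_part mdeg_add)
    then have "homogeneous e (h - g1 * \<Omega>)"
      using homogeneous_add[OF hr(3) homogeneous_uminus] by fastforce
    moreover have "avoids_degree e (g2 * \<Omega>)"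
      using keys_mult[of g2 \<Omega>] \<Omega>(2)
      by (force simp: homogeneous_iff avoids_degree_def g2_def keys_part mdeg_add)
    then have "avoids_degree e (r - g2 * \<Omega>)"
      by (rule avoids_degree_diff[OF hr(4)])
    ultimately have "h - g1 * \<Omega> = 0"
      by (rule homogeneous_add_avoids_degree_eq_zero)
    moreover have "g1 \<in> polys (n + 1)" using g(1) by (auto simp: g1_def)
    ultimately show "\<theta> h = \<zero>\<^bsub>K\<^esub>"
      using kernel[OF hr(1)] by auto
  qed simp
  have "is_valuation n (- 1) K val"
  proof (rule val_is_valuation)
    fix "is" :: "nat list" assume "is": "length is = n" "set is \<subseteq> {..<n + 1}"
    then have sub: "set (map var is :: 'k mvpoly list) \<subseteq> polys (n + 1)"
      by auto
    then have "\<lbrace>map (\<lambda>i. \<theta> (var i)) is\<rbrace>\<^bsub>K\<^esub> = \<theta> (jac n \<Omega> (map var is))"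
      using PQ.nambu_hom_proj(2)[OF \<iota>, of "map var is"] "is"(1) by (simp add: \<theta>_def comp_def)
    moreover have "\<theta> (jac n \<Omega> (map var is)) \<in> R (1 * int (d - 1))"
      using jac_closed[OF _ sub \<Omega>(1)] jac_vars_homogeneous[OF \<Omega>(2) "is"(1)] "is"(1)
      by (intro homogeneous_R) auto
    then have "\<theta> (jac n \<Omega> (map var is)) \<in> R (1 + int n * 1)"
      \<comment> \<open>This needs \<open>d - 1 \<ge> 1 + n\<close>; degree \<open>n + 1\<close>
        would fall short by one.\<close>
      by (rule R_mono) (use d in simp)
    ultimately show "\<lbrace>map (\<lambda>i. \<theta> (var i)) is\<rbrace>\<^bsub>K\<^esub> \<in> R (1 + int n * 1)"
      by simp
  qed
  then show ?thesis by blast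
qed

theorem corollary5p10:
  fixes \<Omega>\<^sub>0 :: "'k::field_char_0 mvpoly"
    and n deg\<Omega>\<^sub>0 :: nat
    and N :: "('k, 'a) nambu"
    and K :: "('k, 'b) nambu"
  assumes "n \<ge> 3"
    and "is_potential (n + 1) deg\<Omega>\<^sub>0 \<Omega>\<^sub>0"
    and "deg\<Omega>\<^sub>0 \<ge> n + 1"
    and "is_nambu_fraction_field n (P_alg n \<Omega>\<^sub>0 1) N"
    and "nambu_poisson_field n K"
    and "gk_dim K = ereal (real n)"
  shows "(nontrivial_valuations n (-1) K \<noteq> {} \<longrightarrow> nambu_hom n N K = {}) \<and>
    (is_weyl_field n K \<or>
      (\<exists>\<Omega> d\<^sub>0. is_potential (n + 1) (n + 1 + d\<^sub>0) \<Omega> \<and> n + 1 + d\<^sub>0 \<noteq> n + 1 \<and>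
        is_nambu_fraction_field n (P_alg n \<Omega> 0) K)
      \<longrightarrow> nambu_hom n N K = {})"
proof (intro conjI impI)
  note no_hom = no_hom_of_valuation[OF assms(2-5)]
  show "nambu_hom n N K = {}" if "nontrivial_valuations n (-1) K \<noteq> {}"
    using that no_hom by (auto simp: nontrivial_valuations_def)
  assume "is_weyl_field n K \<or>
      (\<exists>\<Omega> d\<^sub>0. is_potential (n + 1) (n + 1 + d\<^sub>0) \<Omega> \<and> n + 1 + d\<^sub>0 \<noteq> n + 1 \<and>
        is_nambu_fraction_field n (P_alg n \<Omega> 0) K)"
  then show "nambu_hom n N K = {}"
  proof (elim disjE exE conjE)
    assume "is_weyl_field n K"
    with assms(1) show ?thesis
      using weyl_field_valuation[of n K] no_hom by auto
  next
    fix \<Omega> d\<^sub>0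
    assume "is_potential (n + 1) (n + 1 + d\<^sub>0) \<Omega>" "n + 1 + d\<^sub>0 \<noteq> n + 1"
      "is_nambu_fraction_field n (P_alg n \<Omega> 0) K"
    \<comment> \<open>A nonzero \<open>d\<^sub>0\<close> puts the degree at \<open>n + 2\<close> or
      above.\<close>
    then show ?thesis
      using potential_field_valuation[of n "n + 1 + d\<^sub>0" \<Omega> K] no_hom by auto
  qed
qed

end
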